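(* Let $\mathcal{H}$ be a separable infinite-dimensional complex Hilbert space, $T$ a bounded linear operator on $\mathcal{H}$, and $n,k$ positive integers. Then $T$ is a completely non-unitary contraction such that $\mathcal{D}_T\subseteq\mathcal{D}_{T^*}$, $\dim\mathcal{D}_T=n$, $\dim\mathcal{D}_{T^*}<\infty$ and $\dim(\mathcal{D}_{T^*}\ominus\mathcal{D}_T)=k$ if and only if there exists an orthonormal basis $\{e_m\}_{m\geq1}$ of $\mathcal{H}$ with respect to which $T=S_k+F$, where $S_k e_m=e_{m+k}$ ($m\ge 1$) is the unilateral shift of multiplicity $k$ and $F$ is a finite rank operator such that, writing $P_j$ for the orthogonal projection onto $\mathrm{span}\{e_1,\dots,e_j\}$, $F_1=F+S_kP_n$ and $F_r=F_1^r+\sum_{j=1}^{r-1}S_k^{j}(I-P_n)F_1^{r-j}$ for $r\ge2$, the following hold: (1) $\mathrm{rank}(P_n-F_1^*F_1)=n$; (2) $F_1(I-P_n)=(I-P_{n+k})F_1=0$; (3) there exists $\lambda\geq 0$ such that $\lambda\|F_1^*x\|^2-\|F_1x\|^2\leq \lambda \|P_{n+k} x\|^2-\|P_n x\|^2$ for all $x\in \mathcal{H}$; (4) for all $r\geq 1$ and $x\in\mathcal{H}$, $\|F_rx\|\leq \|P_n x\|$ and $\|F_r^*x\|\leq \|P_{n+kr}x\|$, and the only $x$ satisfying $\|F_rx\|=\|P_nx\|$ and $\|F_r^*x\|=\|P_{n+kr}x\|$ for all $r\geq1$ is $x=0$.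
   Context: For a contraction $T$ on a Hilbert space $\mathcal{H}$, $D_T=(I-T^*T)^{1/2}$, $D_{T^*}=(I-TT^* )^{1/2}$, $\mathcal{D}_T=\overline{D_T\mathcal{H}}$, $\mathcal{D}_{T^*}=\overline{D_{T^*}\mathcal{H}}$. A contraction is completely non-unitary if it has no nonzero reducing subspace on which it is unitary. *)

theory Defs
  imports "HOL-Analysis.Analysis"
begin

class scaleC =
  fixes scaleC :: "complex \<Rightarrow> 'a \<Rightarrow> 'a"

class complex_vector = scaleC + ab_group_add +
  assumes scaleC_add_right: "scaleC a (x + y) = scaleC a x + scaleC a y"
    and scaleC_add_left: "scaleC (a + b) x = scaleC a x + scaleC b x"
    and scaleC_scaleC: "scaleC a (scaleC b x) = scaleC (a * b) x"
    and scaleC_one: "scaleC 1 x = x"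

class complex_inner = real_normed_vector + complex_vector +
  fixes cinner :: "'a \<Rightarrow> 'a \<Rightarrow> complex"
  assumes scaleR_scaleC: "scaleR r x = scaleC (complex_of_real r) x"
    and cinner_commute: "cinner x y = cnj (cinner y x)"
    and cinner_add_left: "cinner (x + y) z = cinner x z + cinner y z"
    and cinner_scaleC_left: "cinner (scaleC c x) y = c * cinner x y"
    and cinner_ge_zero: "0 \<le> Re (cinner x x)"
    and cinner_eq_zero_iff: "cinner x x = 0 \<longleftrightarrow> x = 0"
    and norm_eq_sqrt_cinner: "norm x = sqrt (Re (cinner x x))"

class chilbert_space = complex_inner + complete_space

definition csubspace :: "'a::complex_vector set \<Rightarrow> bool" where
  "csubspace M \<longleftrightarrow> 0 \<in> M \<and> (\<forall>x\<in>M. \<forall>y\<in>M. x + y \<in> M) \<and> (\<forall>c. \<forall>x\<in>M. scaleC c x \<in> M)"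

definition cspan :: "'a::complex_vector set \<Rightarrow> 'a set" where
  "cspan S = {x. \<exists>F c. finite F \<and> F \<subseteq> S \<and> x = (\<Sum>v\<in>F. scaleC (c v) v)}"

definition cindependent :: "'a::complex_vector set \<Rightarrow> bool" where
  "cindependent S \<longleftrightarrow> (\<forall>F c. finite F \<longrightarrow> F \<subseteq> S \<longrightarrow> (\<Sum>v\<in>F. scaleC (c v) v) = 0
      \<longrightarrow> (\<forall>v\<in>F. c v = 0))"

definition has_cdim :: "'a::complex_vector set \<Rightarrow> nat \<Rightarrow> bool" where
  "has_cdim V n \<longleftrightarrow> (\<exists>B. B \<subseteq> V \<and> finite B \<and> card B = n \<and> cindependent B \<and> cspan B = V)"

definition fin_cdim :: "'a::complex_vector set \<Rightarrow> bool" where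
  "fin_cdim V \<longleftrightarrow> (\<exists>n. has_cdim V n)"

definition separable_space :: "'a::topological_space itself \<Rightarrow> bool" where
  "separable_space _ \<longleftrightarrow> (\<exists>D::'a set. countable D \<and> closure D = UNIV)"

definition bounded_clinear_op :: "('a::complex_inner \<Rightarrow> 'a) \<Rightarrow> bool" where
  "bounded_clinear_op T \<longleftrightarrow>
     (\<forall>x y. T (x + y) = T x + T y) \<and> (\<forall>c x. T (scaleC c x) = scaleC c (T x)) \<and>
     (\<exists>K. \<forall>x. norm (T x) \<le> K * norm x)"

definition is_adjoint :: "('a::complex_inner \<Rightarrow> 'a) \<Rightarrow> ('a \<Rightarrow> 'a) \<Rightarrow> bool" where
  "is_adjoint T S \<longleftrightarrow> (\<forall>x y. cinner (T x) y = cinner x (S y))"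

text \<open>The Hilbert space adjoint (exists uniquely for bounded operators on a Hilbert space).\<close>
definition adj :: "('a::complex_inner \<Rightarrow> 'a) \<Rightarrow> ('a \<Rightarrow> 'a)" where
  "adj T = (SOME S. is_adjoint T S)"

definition contraction :: "('a::complex_inner \<Rightarrow> 'a) \<Rightarrow> bool" where
  "contraction T \<longleftrightarrow> bounded_clinear_op T \<and> (\<forall>x. norm (T x) \<le> norm x)"

definition positive_op :: "('a::complex_inner \<Rightarrow> 'a) \<Rightarrow> bool" where
  "positive_op A \<longleftrightarrow> bounded_clinear_op A \<and>
     (\<forall>x. Im (cinner (A x) x) = 0 \<and> 0 \<le> Re (cinner (A x) x))"

definition op_sqrt :: "('a::complex_inner \<Rightarrow> 'a) \<Rightarrow> ('a \<Rightarrow> 'a)" where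
  "op_sqrt A = (THE B. positive_op B \<and> B \<circ> B = A)"

definition defect_op :: "('a::complex_inner \<Rightarrow> 'a) \<Rightarrow> ('a \<Rightarrow> 'a)" where
  "defect_op T = op_sqrt (\<lambda>x. x - adj T (T x))"

definition defect_space :: "('a::complex_inner \<Rightarrow> 'a) \<Rightarrow> 'a set" where
  "defect_space T = closure (range (defect_op T))"

definition orth_diff :: "'a::complex_inner set \<Rightarrow> 'a set \<Rightarrow> 'a set" where
  "orth_diff M N = {x \<in> M. \<forall>y\<in>N. cinner x y = 0}"

definition reducing_subspace :: "('a::complex_inner \<Rightarrow> 'a) \<Rightarrow> 'a set \<Rightarrow> bool" where
  "reducing_subspace T M \<longleftrightarrow> csubspace M \<and> closed M \<and> T ` M \<subseteq> M \<and> adj T ` M \<subseteq> M"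

definition unitary_on :: "('a::complex_inner \<Rightarrow> 'a) \<Rightarrow> 'a set \<Rightarrow> bool" where
  "unitary_on T M \<longleftrightarrow> (\<forall>x\<in>M. norm (T x) = norm x) \<and> T ` M = M"

definition completely_non_unitary :: "('a::complex_inner \<Rightarrow> 'a) \<Rightarrow> bool" where
  "completely_non_unitary T \<longleftrightarrow>
     \<not> (\<exists>M. reducing_subspace T M \<and> M \<noteq> {0} \<and> unitary_on T M)"

definition finite_rank :: "('a::complex_inner \<Rightarrow> 'a) \<Rightarrow> bool" where
  "finite_rank F \<longleftrightarrow> fin_cdim (range F)"

definition rank_eq :: "('a::complex_inner \<Rightarrow> 'a) \<Rightarrow> nat \<Rightarrow> bool" where
  "rank_eq F n \<longleftrightarrow> has_cdim (range F) n"

text \<open>The paper's basis e_1, e_2, ... is represented by e 0, e 1, ....\<close>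
definition orthonormal_basis :: "(nat \<Rightarrow> 'a::complex_inner) \<Rightarrow> bool" where
  "orthonormal_basis e \<longleftrightarrow> (\<forall>i j. cinner (e i) (e j) = (if i = j then 1 else 0))
      \<and> closure (cspan (range e)) = UNIV"

definition shift_op :: "(nat \<Rightarrow> 'a::complex_inner) \<Rightarrow> nat \<Rightarrow> 'a \<Rightarrow> 'a" where
  "shift_op e k x = (\<Sum>m. scaleC (cinner x (e m)) (e (m + k)))"

definition proj_op :: "(nat \<Rightarrow> 'a::complex_inner) \<Rightarrow> nat \<Rightarrow> 'a \<Rightarrow> 'a" where
  "proj_op e j x = (\<Sum>m<j. scaleC (cinner x (e m)) (e m))"

definition F_iter :: "(nat \<Rightarrow> 'a::complex_inner) \<Rightarrow> nat \<Rightarrow> nat \<Rightarrow> ('a \<Rightarrow> 'a) \<Rightarrow> nat \<Rightarrow> 'a \<Rightarrow> 'a" where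
  "F_iter e k n F1 r x =
     (F1 ^^ r) x + (\<Sum>j\<in>{1..<r}. (shift_op e k ^^ j) ((F1 ^^ (r - j)) x - proj_op e n ((F1 ^^ (r - j)) x)))"

end

theory Submission
  imports Defs
begin

text \<open>
  Since \<open>D\<^sub>T\<close> is the positive square root of \<open>I - T\<^sup>*T\<close>, the defect space of \<open>T\<close> is the orthogonal
  complement of \<open>ker (I - T\<^sup>*T) = {x. \<parallel>Tx\<parallel> = \<parallel>x\<parallel>}\<close>, and \<open>T\<close> maps this kernel isometrically onto
  \<open>ker (I - TT\<^sup>*)\<close>. If \<open>\<D>\<^sub>T \<subseteq> \<D>\<^sub>T\<^sub>*\<close>, then \<open>T\<close> restricts to an isometry of \<open>\<D>\<^sub>T\<^sup>\<bottom>\<close>, whose unitary part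
  would reduce \<open>T\<close>; by complete non-unitarity it is a pure shift with wandering subspace
  \<open>\<D>\<^sub>T\<^sub>* \<ominus> \<D>\<^sub>T\<close>. Orthonormal bases of \<open>\<D>\<^sub>T\<close> and of the wandering subspace therefore generate a basis
  in which \<open>T\<close> agrees with \<open>S\<^sub>k\<close> on \<open>(I - P\<^sub>n)H\<close>.

  In such a basis \<open>F\<^sub>1 = T P\<^sub>n\<close> and \<open>T\<^sup>r = F\<^sub>r + S\<^sub>k\<^sup>r(I - P\<^sub>n)\<close> with orthogonal ranges, so condition (4)
  says that \<open>T\<close> is a contraction without a unitary part, and \<open>P\<^sub>n - F\<^sub>1\<^sup>*F\<^sub>1 = I - T\<^sup>*T\<close>, so condition
  (1) gives \<open>\<D>\<^sub>T = P\<^sub>n H\<close>. Condition (3) compares \<open>I - T\<^sup>*T\<close> with \<open>I - TT\<^sup>*\<close>, which is positive definite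
  on the finite-dimensional space \<open>\<D>\<^sub>T\<^sub>*\<close>.
\<close>

subsection \<open>Complex inner products\<close>

lemma cinner_add_right: "cinner x (y + z) = cinner x y + cinner x (z::'a::complex_inner)"
  by (metis cinner_commute cinner_add_left complex_cnj_add)

lemma cinner_scaleC_right: "cinner x (scaleC c y) = cnj c * cinner x (y::'a::complex_inner)"
  by (metis cinner_commute cinner_scaleC_left complex_cnj_mult)

text \<open>Connects \<open>complex_vector\<close> with the general theory of vector spaces over a
  field, so that \<open>cvs.span\<close>, \<open>cvs.subspace\<close> and
  \<open>cvs.independent\<close> are available for complex scalars.\<close>

global_interpretation cvs: vector_space "scaleC :: complex \<Rightarrow> 'a \<Rightarrow> 'a::complex_vector"
  by unfold_locales (simp_all add: scaleC_add_right scaleC_add_left scaleC_scaleC scaleC_one)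

lemma cinner_zero_left [simp]: "cinner 0 (y::'a::complex_inner) = 0"
  by (metis add_cancel_right_right cinner_add_left)

lemma cinner_zero_right [simp]: "cinner (y::'a::complex_inner) 0 = 0"
  by (metis cinner_commute cinner_zero_left complex_cnj_zero)

lemma cinner_minus_left: "cinner (- x) (y::'a::complex_inner) = - cinner x y"
  by (metis add.right_inverse add_eq_0_iff cinner_add_left cinner_zero_left)

lemma cinner_minus_right: "cinner x (- y::'a::complex_inner) = - cinner x y"
  by (metis add.right_inverse add_eq_0_iff cinner_add_right cinner_zero_right)

lemma cinner_diff_left: "cinner (x - y) (z::'a::complex_inner) = cinner x z - cinner y z"
  by (metis add_uminus_conv_diff cinner_add_left cinner_minus_left)

lemma cinner_diff_right: "cinner x (y - z::'a::complex_inner) = cinner x y - cinner x z"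
  by (metis add_uminus_conv_diff cinner_add_right cinner_minus_right)

lemma cinner_sum_left: "cinner (\<Sum>i\<in>I. f i) (y::'a::complex_inner) = (\<Sum>i\<in>I. cinner (f i) y)"
  by (induction I rule: infinite_finite_induct) (simp_all add: cinner_add_left)

lemma cinner_sum_right: "cinner (y::'a::complex_inner) (\<Sum>i\<in>I. f i) = (\<Sum>i\<in>I. cinner y (f i))"
  by (induction I rule: infinite_finite_induct) (simp_all add: cinner_add_right)

lemmas cinner_simps = cinner_add_left cinner_add_right cinner_diff_left cinner_diff_right
  cinner_scaleC_left cinner_scaleC_right cinner_minus_left cinner_minus_right

lemma cinner_same: "cinner x x = complex_of_real ((norm (x::'a::complex_inner))\<^sup>2)"
proof -
  have "Im (cinner x x) = 0"
    using arg_cong[OF cinner_commute[of x x], of Im] by simp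
  moreover have "(norm x)\<^sup>2 = Re (cinner x x)"
    by (simp add: norm_eq_sqrt_cinner cinner_ge_zero)
  ultimately show ?thesis by (simp add: complex_eq_iff)
qed

lemma norm_sq_cinner: "(norm (x::'a::complex_inner))\<^sup>2 = Re (cinner x x)"
  by (simp add: cinner_same)

lemma norm_scaleC [simp]: "norm (scaleC c (x::'a::complex_inner)) = cmod c * norm x"
proof -
  have "complex_of_real ((norm (scaleC c x))\<^sup>2) = c * cnj c * complex_of_real ((norm x)\<^sup>2)"
    unfolding cinner_same[symmetric] by (simp add: cinner_scaleC_left cinner_scaleC_right)
  also have "\<dots> = complex_of_real ((cmod c * norm x)\<^sup>2)"
    by (simp add: complex_norm_square[symmetric] power_mult_distrib)
  finally have "(norm (scaleC c x))\<^sup>2 = (cmod c * norm x)\<^sup>2"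
    unfolding of_real_eq_iff .
  then show ?thesis by (simp add: power2_eq_iff_nonneg)
qed

lemma norm_diff_sq:
  "(norm (x - y::'a::complex_inner))\<^sup>2 = (norm x)\<^sup>2 - 2 * Re (cinner x y) + (norm y)\<^sup>2"
  using arg_cong[OF cinner_commute[of x y], of Re]
  by (simp add: norm_sq_cinner cinner_simps)

lemma norm_add_sq:
  "(norm (x + y::'a::complex_inner))\<^sup>2 = (norm x)\<^sup>2 + 2 * Re (cinner x y) + (norm y)\<^sup>2"
  using arg_cong[OF cinner_commute[of x y], of Re]
  by (simp add: norm_sq_cinner cinner_simps)

lemma norm_add_sq_orth:
  "cinner x y = 0 \<Longrightarrow> (norm (x + y::'a::complex_inner))\<^sup>2 = (norm x)\<^sup>2 + (norm y)\<^sup>2"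
  by (simp add: norm_add_sq)

lemma norm_sum_sq_orth:
  fixes f :: "'i \<Rightarrow> 'a::complex_inner"
  assumes "finite I" "\<And>i j. i \<in> I \<Longrightarrow> j \<in> I \<Longrightarrow> i \<noteq> j \<Longrightarrow> cinner (f i) (f j) = 0"
  shows "(norm (\<Sum>i\<in>I. f i))\<^sup>2 = (\<Sum>i\<in>I. (norm (f i))\<^sup>2)"
  using assms
proof (induction I rule: finite_induct)
  case (insert i I)
  have "cinner (f i) (\<Sum>i\<in>I. f i) = 0"
    unfolding cinner_sum_right using insert by (intro sum.neutral) auto
  then show ?case using insert by (simp add: norm_add_sq_orth)
qed simp

text \<open>With \<open>scaleC c y\<close> the component of \<open>x\<close> along \<open>y\<close>,
  the remainder is orthogonal to it, and Pythagoras gives |c| |y| \<le> |x|.\<close>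

lemma cauchy_schwarz: "cmod (cinner x y) \<le> norm x * norm (y::'a::complex_inner)"
proof (cases "y = 0")
  case False
  define c where "c = cinner x y / complex_of_real ((norm y)\<^sup>2)"
  have ny: "complex_of_real ((norm y)\<^sup>2) \<noteq> 0" using False by simp
  have "cinner (x - scaleC c y) (scaleC c y) = 0"
    using ny by (simp add: cinner_simps cinner_same c_def)
  then have "(norm (x - scaleC c y + scaleC c y))\<^sup>2 = (norm (x - scaleC c y))\<^sup>2 + (norm (scaleC c y))\<^sup>2"
    by (rule norm_add_sq_orth)
  then have "(cmod c * norm y)\<^sup>2 \<le> (norm x)\<^sup>2"
    by simp
  then have "cmod c * norm y \<le> norm x"
    by (rule power2_le_imp_le) simp_all
  moreover have "cmod c = cmod (cinner x y) / (norm y)\<^sup>2"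
    by (simp add: c_def norm_divide norm_power)
  ultimately show ?thesis using False by (simp add: field_simps power2_eq_square)
qed simp

lemma bounded_bilinear_cinner:
  "bounded_bilinear (cinner :: 'a::complex_inner \<Rightarrow> 'a \<Rightarrow> complex)"
proof
  show "\<exists>K. \<forall>a b::'a. cmod (cinner a b) \<le> norm a * norm b * K"
    using cauchy_schwarz by (intro exI[of _ 1]) auto
qed (simp_all add: cinner_simps scaleR_scaleC scaleR_conv_of_real)

lemmas tendsto_cinner = bounded_bilinear.tendsto[OF bounded_bilinear_cinner]
lemmas continuous_on_cinner [continuous_intros] =
  bounded_bilinear.continuous_on[OF bounded_bilinear_cinner]

lemma bounded_linear_scaleC: "bounded_linear (scaleC c :: 'a::complex_inner \<Rightarrow> 'a)"
  by (rule bounded_linear_intro[of _ "cmod c"])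
    (simp_all add: scaleC_add_right scaleR_scaleC scaleC_scaleC mult.commute)

lemma cinner_eqI:
  assumes "\<And>z. cinner x z = cinner y (z::'a::complex_inner)" shows "x = y"
  using assms[of "x - y"] by (metis cinner_diff_left cinner_eq_zero_iff eq_iff_diff_eq_0)

subsection \<open>Orthogonal complements and the projection theorem\<close>

definition orth_compl :: "'a::complex_inner set \<Rightarrow> 'a set" where
  "orth_compl M = {x. \<forall>y\<in>M. cinner x y = 0}"

lemma cinner_zero_commute: "cinner x y = 0 \<longleftrightarrow> cinner y (x::'a::complex_inner) = 0"
  by (metis cinner_commute complex_cnj_zero_iff)

lemma csubspace_eq_subspace: "csubspace = cvs.subspace"
  by (auto simp: csubspace_def cvs.subspace_def fun_eq_iff)

lemma cspan_eq_span: "cspan = cvs.span"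
  by (auto simp: cspan_def cvs.span_explicit fun_eq_iff)

lemma cindependent_eq: "cindependent S \<longleftrightarrow> cvs.independent S"
  unfolding cindependent_def cvs.independent_explicit_module by blast

lemma subspace_orth_compl: "cvs.subspace (orth_compl M)"
  by (auto simp: cvs.subspace_def orth_compl_def cinner_simps)

lemma closed_orth_compl: "closed (orth_compl (M::'a::complex_inner set))"
proof -
  have "orth_compl M = (\<Inter>y\<in>M. {x. cinner x y = 0})"
    by (auto simp: orth_compl_def)
  moreover have "closed {x. cinner x y = 0}" for y :: 'a
    by (intro closed_Collect_eq continuous_intros)
  ultimately show ?thesis by auto
qed

lemma subspace_closure:
  assumes "cvs.subspace (M::'a::complex_inner set)" shows "cvs.subspace (closure M)"
  unfolding cvs.subspace_def
proof (intro conjI ballI allI)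
  show "0 \<in> closure M" using assms closure_subset cvs.subspace_0 by blast
next
  fix x y assume "x \<in> closure M" "y \<in> closure M"
  then obtain f g where "\<forall>n. f n \<in> M" "f \<longlonglongrightarrow> x" "\<forall>n. g n \<in> M" "g \<longlonglongrightarrow> y"
    unfolding closure_sequential by blast
  then show "x + y \<in> closure M"
    unfolding closure_sequential
    by (intro exI[of _ "\<lambda>n. f n + g n"]) (auto intro: tendsto_add cvs.subspace_add[OF assms])
next
  fix c x assume "x \<in> closure M"
  then obtain f where "\<forall>n. f n \<in> M" "f \<longlonglongrightarrow> x"
    unfolding closure_sequential by blast
  then show "scaleC c x \<in> closure M"
    unfolding closure_sequential
    by (intro exI[of _ "\<lambda>n. scaleC c (f n)"])
      (auto intro: bounded_linear.tendsto[OF bounded_linear_scaleC] cvs.subspace_scale[OF assms])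
qed

lemma parallelogram:
  "(norm (x + y))\<^sup>2 + (norm (x - y::'a::complex_inner))\<^sup>2 = 2 * (norm x)\<^sup>2 + 2 * (norm y)\<^sup>2"
  by (simp add: norm_add_sq norm_diff_sq)

text \<open>A minimizing sequence is Cauchy: the midpoint of two near-minimizers lies in
  \<open>M\<close>, so its distance from \<open>x\<close> is at least \<open>d\<close>, and the
  parallelogram law then forces the two points together.\<close>

lemma closest_point_exists:
  fixes M :: "'a::chilbert_space set"
  assumes M: "cvs.subspace M" "closed M"
  shows "\<exists>m\<in>M. \<forall>y\<in>M. norm (x - m) \<le> norm (x - y)"
proof -
  define d where "d = (INF y\<in>M. norm (x - y))"
  have bdd: "bdd_below ((\<lambda>y. norm (x - y)) ` M)" by (rule bdd_belowI[of _ 0]) auto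
  have ne: "M \<noteq> {}" using M(1) cvs.subspace_0 by blast
  have d_le: "d \<le> norm (x - y)" if "y \<in> M" for y
    unfolding d_def using bdd that by (rule cINF_lower)
  have d0: "0 \<le> d" unfolding d_def using ne by (intro cINF_greatest) auto
  \<comment> \<open>The excess is measured on squared distances, so that it enters the parallelogram
    law linearly.\<close>
  have "\<exists>y\<in>M. (norm (x - y))\<^sup>2 < d\<^sup>2 + inverse (real (Suc j))" for j
  proof -
    have "d < sqrt (d\<^sup>2 + inverse (real (Suc j)))"
      using d0 by (intro real_less_rsqrt) simp
    then obtain y where "y \<in> M" "norm (x - y) < sqrt (d\<^sup>2 + inverse (real (Suc j)))"
      unfolding d_def using cINF_less_iff[OF ne bdd] by blast
    then have "(norm (x - y))\<^sup>2 < (sqrt (d\<^sup>2 + inverse (real (Suc j))))\<^sup>2"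
      by (intro power_strict_mono) auto
    then show ?thesis using \<open>y \<in> M\<close> by (intro bexI[of _ y]) (simp_all add: add_nonneg_nonneg)
  qed
  then obtain f where fM: "\<And>j. f j \<in> M" and f: "\<And>j. (norm (x - f j))\<^sup>2 < d\<^sup>2 + inverse (real (Suc j))"
    by metis
  have key: "(norm (f i - f j))\<^sup>2 \<le> 2 * inverse (real (Suc i)) + 2 * inverse (real (Suc j))" for i j
  proof -
    have "scaleC (1/2) (f i + f j) \<in> M"
      using M(1) fM cvs.subspace_add cvs.subspace_scale by blast
    then have "d \<le> norm (x - scaleC (1/2) (f i + f j))" by (rule d_le)
    also have "x - scaleC (1/2) (f i + f j) = scaleC (1/2) ((x - f i) + (x - f j))"
      by (simp add: cvs.scale_right_diff_distrib scaleC_add_right scaleC_one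
          flip: cvs.scale_left_distrib)
    finally have "2 * d \<le> norm ((x - f i) + (x - f j))" by simp
    then have "(2 * d)\<^sup>2 \<le> (norm ((x - f i) + (x - f j)))\<^sup>2"
      using d0 by (intro power_mono) auto
    moreover have "(x - f i) - (x - f j) = f j - f i" by simp
    ultimately show ?thesis
      using parallelogram[of "x - f i" "x - f j"] f[of i] f[of j] norm_minus_commute[of "f i" "f j"]
      by (simp add: power_mult_distrib)
  qed
  have "Cauchy f"
  proof (rule metric_CauchyI)
    fix e :: real assume "0 < e"
    then obtain N where N: "inverse (real (Suc N)) < e\<^sup>2 / 4"
      using reals_Archimedean[of "e\<^sup>2 / 4"] by auto
    show "\<exists>N. \<forall>i\<ge>N. \<forall>j\<ge>N. dist (f i) (f j) < e"
    proof (intro exI allI impI)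
      fix i j assume "N \<le> i" "N \<le> j"
      then have "inverse (real (Suc i)) \<le> inverse (real (Suc N))"
        "inverse (real (Suc j)) \<le> inverse (real (Suc N))" by (auto simp: field_simps)
      then have "(norm (f i - f j))\<^sup>2 < e\<^sup>2"
        using key[of i j] N by linarith
      then show "dist (f i) (f j) < e"
        using \<open>0 < e\<close> by (simp add: dist_norm power_less_imp_less_base)
    qed
  qed
  then obtain m where m: "f \<longlonglongrightarrow> m"
    using Cauchy_convergent convergent_def by blast
  have "m \<in> M" using M(2) fM m closed_sequentially by blast
  have "(\<lambda>j. (norm (x - f j))\<^sup>2) \<longlonglongrightarrow> (norm (x - m))\<^sup>2"
    by (intro tendsto_intros m)
  moreover have "(\<lambda>j. d\<^sup>2 + inverse (real (Suc j))) \<longlonglongrightarrow> d\<^sup>2 + 0"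
    by (intro tendsto_intros LIMSEQ_inverse_real_of_nat)
  ultimately have "(norm (x - m))\<^sup>2 \<le> d\<^sup>2 + 0"
    using f by (intro LIMSEQ_le[of "\<lambda>j. (norm (x - f j))\<^sup>2"]) (auto intro: less_imp_le)
  then have "norm (x - m) \<le> d" using d0 power2_le_imp_le[of "norm (x - m)" d] by simp
  then show ?thesis using \<open>m \<in> M\<close> d_le order_trans by blast
qed

text \<open>The closest point \<open>m\<close> works: if \<open>x - m\<close> had a nonzero
  component along some \<open>y\<close> in \<open>M\<close>, moving \<open>m\<close> by that
  component would shorten the distance.\<close>

theorem projection_theorem:
  fixes M :: "'a::chilbert_space set"
  assumes M: "cvs.subspace M" "closed M"
  obtains m where "m \<in> M" "x - m \<in> orth_compl M"
proof -
  obtain m where m: "m \<in> M" and min: "\<And>y. y \<in> M \<Longrightarrow> norm (x - m) \<le> norm (x - y)"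
    using closest_point_exists[OF M] by blast
  have "cinner (x - m) y = 0" if y: "y \<in> M" for y
  proof (cases "y = 0")
    case False
    define c where "c = cinner (x - m) y / complex_of_real ((norm y)\<^sup>2)"
    have ny: "complex_of_real ((norm y)\<^sup>2) \<noteq> 0" using False by simp
    have orth: "cinner (x - m - scaleC c y) (scaleC c y) = 0"
      using ny by (simp add: cinner_simps cinner_same c_def)
    have "norm (x - m) \<le> norm (x - (m + scaleC c y))"
      by (rule min) (use M(1) m y cvs.subspace_add cvs.subspace_scale in blast)
    then have "(norm (x - m))\<^sup>2 \<le> (norm (x - m - scaleC c y))\<^sup>2"
      by (simp add: algebra_simps)
    moreover have "(norm (x - m))\<^sup>2 = (norm (x - m - scaleC c y))\<^sup>2 + (norm (scaleC c y))\<^sup>2"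
      using norm_add_sq_orth[OF orth] by simp
    ultimately have "scaleC c y = 0" by simp
    then have "c = 0" using False by simp
    then show ?thesis using ny by (simp add: c_def)
  qed simp
  then show thesis using that m by (auto simp: orth_compl_def)
qed

text \<open>If \<open>x\<close> lies in the double complement and \<open>m\<close> is its projection
  to the closure, then \<open>x - m\<close> is orthogonal to both \<open>x\<close> and
  \<open>m\<close>, hence to itself.\<close>

lemma orth_compl_orth_compl:
  fixes M :: "'a::chilbert_space set"
  assumes "cvs.subspace M"
  shows "orth_compl (orth_compl M) = closure M"
proof
  have "M \<subseteq> orth_compl (orth_compl M)"
    by (auto simp: orth_compl_def cinner_zero_commute)
  then show "closure M \<subseteq> orth_compl (orth_compl M)"
    by (simp add: closed_orth_compl closure_minimal)
next
  show "orth_compl (orth_compl M) \<subseteq> closure M"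
  proof
    fix x assume x: "x \<in> orth_compl (orth_compl M)"
    obtain m where m: "m \<in> closure M" "x - m \<in> orth_compl (closure M)"
      using projection_theorem[OF subspace_closure[OF assms] closed_closure] .
    have "x - m \<in> orth_compl M" using m(2) closure_subset by (auto simp: orth_compl_def)
    then have "cinner x (x - m) = 0" using x by (auto simp: orth_compl_def)
    moreover have "cinner m (x - m) = 0" using m by (auto simp: orth_compl_def cinner_zero_commute)
    ultimately have "cinner (x - m) (x - m) = 0" by (simp add: cinner_diff_left)
    then show "x \<in> closure M" using m by (simp add: cinner_eq_zero_iff)
  qed
qed

subsection \<open>Bounded operators and adjoints\<close>

lemma bounded_clinear_op_module_hom:
  assumes "bounded_clinear_op (T :: 'a::complex_inner \<Rightarrow> 'a)"
  shows "module_hom scaleC scaleC T"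
  using assms unfolding bounded_clinear_op_def
  by unfold_locales auto

lemma bounded_clinear_op_bounded_linear:
  assumes "bounded_clinear_op (T :: 'a::complex_inner \<Rightarrow> 'a)"
  shows "bounded_linear T"
proof -
  obtain K where "\<And>x. norm (T x) \<le> K * norm x"
    using assms unfolding bounded_clinear_op_def by blast
  then show ?thesis
    using assms unfolding bounded_clinear_op_def
    by (intro bounded_linear_intro[of _ K]) (simp_all add: scaleR_scaleC mult.commute)
qed

lemma bounded_clinear_opI:
  assumes "bounded_linear T" "\<And>c x. T (scaleC c x) = scaleC c (T x)"
  shows "bounded_clinear_op (T :: 'a::complex_inner \<Rightarrow> 'a)"
  unfolding bounded_clinear_op_def
  using assms bounded_linear.bounded[OF assms(1)] linear_add[OF bounded_linear.linear[OF assms(1)]]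
  by (auto simp: mult.commute)

lemma bop_scaleC: "bounded_clinear_op T \<Longrightarrow> T (scaleC c x) = scaleC c (T x)"
  by (simp add: bounded_clinear_op_def)

lemma bop_id: "bounded_clinear_op (\<lambda>x. x)"
  by (rule bounded_clinear_opI) simp_all

lemma bop_comp: "bounded_clinear_op A \<Longrightarrow> bounded_clinear_op B \<Longrightarrow> bounded_clinear_op (\<lambda>x. A (B x))"
  by (rule bounded_clinear_opI)
    (auto intro: bounded_linear_compose bounded_clinear_op_bounded_linear simp: bop_scaleC)

lemma bop_add: "bounded_clinear_op A \<Longrightarrow> bounded_clinear_op B \<Longrightarrow> bounded_clinear_op (\<lambda>x. A x + B x)"
  by (rule bounded_clinear_opI)
    (auto intro: bounded_linear_add bounded_clinear_op_bounded_linear simp: bop_scaleC scaleC_add_right)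

lemma bop_diff: "bounded_clinear_op A \<Longrightarrow> bounded_clinear_op B \<Longrightarrow> bounded_clinear_op (\<lambda>x. A x - B x)"
  by (rule bounded_clinear_opI)
    (auto intro: bounded_linear_sub bounded_clinear_op_bounded_linear
      simp: bop_scaleC cvs.scale_right_diff_distrib)

lemma bop_funpow: "bounded_clinear_op A \<Longrightarrow> bounded_clinear_op (A ^^ r)"
proof (induction r)
  case (Suc r)
  then show ?case using bop_comp[of A "A ^^ r"] by (simp add: comp_def)
qed (simp add: bop_id id_def)

lemma bop_simps:
  assumes "bounded_clinear_op (T :: 'a::complex_inner \<Rightarrow> 'a)"
  shows "T (x + y) = T x + T y" "T (x - y) = T x - T y" "T 0 = 0" "T (- x) = - T x"
    "T (scaleC c x) = scaleC c (T x)" "T (sum f I) = (\<Sum>i\<in>I. T (f i))"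
  using bounded_clinear_op_bounded_linear[OF assms] bop_scaleC[OF assms]
  by (simp_all add: linear_simps linear_sum bounded_linear.linear linear_neg)

text \<open>A functional that is not zero has a vector \<open>v\<close> orthogonal to its kernel
  with f(v) nonzero. Since f(v)x - f(x)v lies in the kernel, pairing it with \<open>v\<close> yields
  the formula.\<close>

lemma riesz:
  fixes f :: "'a::chilbert_space \<Rightarrow> complex"
  assumes bl: "bounded_linear f" and sc: "\<And>c x. f (scaleC c x) = c * f x"
  shows "\<exists>w. \<forall>x. f x = cinner x w"
proof (cases "\<forall>x. f x = 0")
  case True then show ?thesis by (intro exI[of _ 0]) simp
next
  case False
  then obtain z where z: "f z \<noteq> 0" by blast
  have add: "f (x + y) = f x + f y" "f (x - y) = f x - f y" for x y
    using bl by (simp_all add: linear_simps)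
  have f0: "f 0 = 0" using sc[of 0 0] by simp
  define M where "M = {x. f x = 0}"
  have "cvs.subspace M" by (auto simp: M_def cvs.subspace_def add sc f0)
  moreover have "closed M" unfolding M_def
    by (intro closed_Collect_eq linear_continuous_on bl continuous_intros)
  ultimately obtain m where m: "m \<in> M" "z - m \<in> orth_compl M"
    using projection_theorem by blast
  define v where "v = z - m"
  have fv: "f v \<noteq> 0" using z m(1) by (simp add: v_def add M_def)
  have nv: "complex_of_real ((norm v)\<^sup>2) \<noteq> 0" using fv f0 by auto
  have "f x = cinner x (scaleC (cnj (f v / complex_of_real ((norm v)\<^sup>2))) v)" for x
  proof -
    have "scaleC (f v) x - scaleC (f x) v \<in> M" by (simp add: M_def add sc)
    then have "cinner (scaleC (f v) x - scaleC (f x) v) v = 0"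
      using m(2) by (simp add: v_def orth_compl_def cinner_zero_commute)
    then show ?thesis using nv by (simp add: cinner_simps cinner_same field_simps)
  qed
  then show ?thesis by blast
qed

text \<open>Adjoints are unique, so the choice operator in \<open>adj\<close> leaves no freedom and
  an adjoint is computed by exhibiting one.\<close>

lemma adj_eqI: "is_adjoint T S \<Longrightarrow> adj T = (S :: 'a::complex_inner \<Rightarrow> 'a)"
proof -
  assume S: "is_adjoint T S"
  then have "is_adjoint T (adj T)" unfolding adj_def by (rule someI[where P = "is_adjoint T"])
  then have "cinner (adj T y) x = cinner (S y) x" for x y
    using S unfolding is_adjoint_def by (metis cinner_commute)
  then show "adj T = S" by (intro ext cinner_eqI) auto
qed

lemma cinner_adj:
  fixes T :: "'a::chilbert_space \<Rightarrow> 'a"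
  assumes "bounded_clinear_op T"
  shows "cinner (T x) y = cinner x (adj T y)"
proof -
  have "\<exists>w. \<forall>x. cinner (T x) y = cinner x w" for y
  proof (rule riesz)
    show "bounded_linear (\<lambda>x. cinner (T x) y)"
      using bounded_linear_compose[OF bounded_bilinear.bounded_linear_left[OF bounded_bilinear_cinner]
          bounded_clinear_op_bounded_linear[OF assms]] .
  qed (simp add: bop_scaleC[OF assms] cinner_simps)
  then have "\<exists>S. is_adjoint T S" unfolding is_adjoint_def by metis
  then have "is_adjoint T (adj T)" using adj_eqI by metis
  then show ?thesis by (simp add: is_adjoint_def)
qed

lemma cinner_adj_left:
  fixes T :: "'a::chilbert_space \<Rightarrow> 'a"
  assumes "bounded_clinear_op T"
  shows "cinner (adj T x) y = cinner x (T y)"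
  by (metis assms cinner_adj cinner_commute)

text \<open>The square of |\<open>adj T y\<close>| is the inner product of
  \<open>T (adj T y)\<close> with \<open>y\<close>; Cauchy-Schwarz applies and one factor
  cancels.\<close>

lemma adj_bound:
  fixes T :: "'a::chilbert_space \<Rightarrow> 'a"
  assumes T: "bounded_clinear_op T" and K: "\<And>x. norm (T x) \<le> K * norm x"
  shows "norm (adj T y) \<le> K * norm y"
proof (cases "adj T y = 0")
  case True
  have "0 \<le> K * norm y" by (rule order_trans[OF norm_ge_zero K])
  then show ?thesis using True by simp
next
  case False
  have "(norm (adj T y))\<^sup>2 = cmod (cinner (T (adj T y)) y)"
    by (simp add: cinner_adj[OF T] cinner_same norm_power)
  also have "\<dots> \<le> norm (T (adj T y)) * norm y" by (rule cauchy_schwarz)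
  also have "\<dots> \<le> K * norm (adj T y) * norm y" using K by (simp add: mult_right_mono)
  finally show ?thesis using False by (simp add: power2_eq_square)
qed

lemma bop_adj:
  fixes T :: "'a::chilbert_space \<Rightarrow> 'a"
  assumes T: "bounded_clinear_op T"
  shows "bounded_clinear_op (adj T)"
  unfolding bounded_clinear_op_def
proof (intro conjI allI)
  show "adj T (x + y) = adj T x + adj T y" for x y
    by (rule cinner_eqI) (simp add: cinner_adj_left[OF T] cinner_simps)
  show "adj T (scaleC c x) = scaleC c (adj T x)" for c x
    by (rule cinner_eqI) (simp add: cinner_adj_left[OF T] cinner_simps)
  show "\<exists>K. \<forall>x. norm (adj T x) \<le> K * norm x"
    using T adj_bound[OF T] unfolding bounded_clinear_op_def by metis
qed

lemma adj_adj: "bounded_clinear_op (T :: 'a::chilbert_space \<Rightarrow> 'a) \<Longrightarrow> adj (adj T) = T"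
  by (rule adj_eqI) (simp add: is_adjoint_def cinner_adj_left)

lemma adj_comp:
  fixes A B :: "'a::chilbert_space \<Rightarrow> 'a"
  shows "bounded_clinear_op A \<Longrightarrow> bounded_clinear_op B \<Longrightarrow> adj (\<lambda>x. A (B x)) = (\<lambda>x. adj B (adj A x))"
  by (rule adj_eqI) (simp add: is_adjoint_def cinner_adj)

lemma adj_funpow:
  fixes A :: "'a::chilbert_space \<Rightarrow> 'a"
  assumes "bounded_clinear_op A" shows "adj (A ^^ r) = adj A ^^ r"
proof (rule adj_eqI)
  have "cinner ((A ^^ r) x) y = cinner x ((adj A ^^ r) y)" for x y
  proof (induction r arbitrary: x)
    case (Suc r)
    have "cinner ((A ^^ Suc r) x) y = cinner ((A ^^ r) (A x)) y" by (simp only: funpow_Suc_right o_apply)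
    also have "\<dots> = cinner x ((adj A ^^ Suc r) y)" by (simp add: Suc cinner_adj[OF assms])
    finally show ?case .
  qed simp
  then show "is_adjoint (A ^^ r) (adj A ^^ r)" by (simp add: is_adjoint_def)
qed

subsection \<open>Positive square roots\<close>

text \<open>Fixed-point iteration for Y = (C + Y^2)/2 started at 0. Every iterate is a polynomial in
  \<open>C\<close>, hence commutes with whatever commutes with \<open>C\<close>.\<close>

fun sqrt_iter :: "('a \<Rightarrow> 'a) \<Rightarrow> nat \<Rightarrow> 'a \<Rightarrow> 'a::complex_inner" where
  "sqrt_iter C 0 = (\<lambda>x. 0)"
| "sqrt_iter C (Suc m) = (\<lambda>x. scaleC (1/2) (C x + sqrt_iter C m (sqrt_iter C m x)))"

text \<open>The same recursion for the number 1 in place of the operator majorizes all norms.\<close>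

fun sqrt_iter_bound :: "nat \<Rightarrow> real" where
  "sqrt_iter_bound 0 = 0"
| "sqrt_iter_bound (Suc m) = (1 + (sqrt_iter_bound m)\<^sup>2) / 2"

lemma sqrt_iter_bound_range: "0 \<le> sqrt_iter_bound m \<and> sqrt_iter_bound m \<le> 1"
  by (induction m) (auto simp: power_le_one)

lemma sqrt_iter_bound_mono: "sqrt_iter_bound m \<le> sqrt_iter_bound (Suc m)"
proof -
  have "0 \<le> (1 - sqrt_iter_bound m)\<^sup>2" by simp
  then show ?thesis by (simp add: power2_diff)
qed

lemma sqrt_iter_bound_convergent: "convergent sqrt_iter_bound"
proof -
  have "incseq sqrt_iter_bound" using sqrt_iter_bound_mono by (rule incseq_SucI)
  moreover have "sqrt_iter_bound i \<le> 1" for i using sqrt_iter_bound_range by blast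
  ultimately show ?thesis
    using incseq_convergent[of sqrt_iter_bound 1] convergentI by metis
qed

lemma bop_zero: "bounded_clinear_op (\<lambda>x. 0)"
  by (rule bounded_clinear_opI) simp_all

lemma bop_scale: "bounded_clinear_op A \<Longrightarrow> bounded_clinear_op (\<lambda>x. scaleC c (A x))"
  by (rule bounded_clinear_opI)
    (auto intro: bounded_linear_compose[OF bounded_linear_scaleC] bounded_clinear_op_bounded_linear
      simp: bop_scaleC scaleC_scaleC mult.commute)

text \<open>Polarization: realness of the quadratic form at \<open>x + y\<close> relates the
  imaginary parts, and replacing \<open>y\<close> by \<open>scaleC \<i> y\<close> relates the real
  parts.\<close>

lemma positive_op_self_adjoint:
  assumes B: "positive_op B"
  shows "cinner (B x) y = cinner x (B y)"
proof -
  have b: "bounded_clinear_op B" and im: "Im (cinner (B z) z) = 0" for z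
    using B by (auto simp: positive_op_def)
  have 1: "Im (cinner (B x) y) + Im (cinner (B y) x) = 0" for x y
    using im[of "x + y"] im[of x] im[of y] by (simp add: bop_simps[OF b] cinner_simps)
  have 2: "Re (cinner (B x) y) = Re (cinner (B y) x)"
    using 1[of x "scaleC \<i> y"] by (simp add: bop_simps[OF b] cinner_simps)
  show ?thesis
    using 1[of x y] 2 by (metis (no_types) cinner_commute complex_cnj complex_surj add_eq_0_iff2)
qed

text \<open>If \<open>B x\<close> were nonzero, then moving from \<open>x\<close> by a small
  multiple of \<open>- B x\<close> would make the form negative, because the term linear in
  \<open>t\<close> dominates the quadratic one.\<close>

lemma positive_op_kernel:
  assumes B: "positive_op B" and x: "Re (cinner (B x) x) = 0"
  shows "B x = 0"
proof (rule ccontr)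
  assume nz: "B x \<noteq> 0"
  have b: "bounded_clinear_op B" and pos: "0 \<le> Re (cinner (B z) z)" for z
    using B by (auto simp: positive_op_def)
  define r where "r = (norm (B x))\<^sup>2"
  define q where "q = Re (cinner (B (B x)) (B x))"
  have r: "r > 0" using nz by (simp add: r_def)
  have expand: "Re (cinner (B (x - scaleC (complex_of_real t) (B x))) (x - scaleC (complex_of_real t) (B x)))
      = t\<^sup>2 * q - 2 * t * r" for t
  proof -
    have "cinner (B (B x)) x = complex_of_real r" "cinner (B x) (B x) = complex_of_real r"
      by (simp_all add: positive_op_self_adjoint[OF B, of "B x" x] cinner_same r_def)
    then show ?thesis using x
      by (simp add: bop_simps[OF b] cinner_simps q_def power2_eq_square algebra_simps)
  qed
  have q: "0 \<le> q" unfolding q_def by (rule pos)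
  \<comment> \<open>The summand 1 covers the case q = 0 and keeps t q \<le> r.\<close>
  define t where "t = r / (q + 1)"
  have "0 \<le> t\<^sup>2 * q - 2 * t * r" using pos expand by metis
  moreover have "t > 0" using r q by (simp add: t_def)
  ultimately have "2 * r \<le> t * q" by (simp add: power2_eq_square algebra_simps)
  moreover have "t * q \<le> r" using r q by (simp add: t_def field_simps)
  ultimately show False using r by simp
qed

text \<open>With \<open>C = I - A\<close>, the limit \<open>Y\<close> of the iteration satisfies \<open>2Y = C + Y\<^sup>2\<close>,
  that is, \<open>(I - Y)\<^sup>2 = A\<close>.\<close>

lemma positive_sqrt_exists:
  fixes A :: "'a::chilbert_space \<Rightarrow> 'a"
  assumes A: "positive_op A" and A1: "\<And>x. norm (x - A x) \<le> norm x"
  shows "\<exists>B. positive_op B \<and> B \<circ> B = A \<and>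
    (\<forall>X. bounded_clinear_op X \<longrightarrow> (\<forall>x. X (A x) = A (X x)) \<longrightarrow> (\<forall>x. X (B x) = B (X x)))"
proof -
  define C where "C = (\<lambda>x. x - A x)"
  have a: "bounded_clinear_op A" using A by (simp add: positive_op_def)
  have C: "bounded_clinear_op C" unfolding C_def by (intro bop_diff bop_id a)
  have Cn: "norm (C x) \<le> norm x" for x using A1 by (simp add: C_def)
  let ?Y = "sqrt_iter C" and ?y = sqrt_iter_bound
  have Y: "bounded_clinear_op (?Y m)" for m
    by (induction m) (auto intro!: bop_zero bop_scale bop_add C intro: bop_comp)
  have Yn: "norm (?Y m x) \<le> ?y m * norm x" for m x
  proof (induction m arbitrary: x)
    case (Suc m)
    have "norm (?Y m (?Y m x)) \<le> ?y m * norm (?Y m x)" by (rule Suc)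
    also have "\<dots> \<le> ?y m * (?y m * norm x)"
      using Suc sqrt_iter_bound_range[of m] by (intro mult_left_mono) auto
    finally have *: "norm (C x + ?Y m (?Y m x)) \<le> norm x + ?y m * (?y m * norm x)"
      using Cn[of x] norm_triangle_ineq[of "C x" "?Y m (?Y m x)"] by linarith
    have Y_eq: "norm (?Y (Suc m) x) = 1/2 * norm (C x + ?Y m (?Y m x))"
      by (simp only: sqrt_iter.simps norm_scaleC) simp
    have y_eq: "?y (Suc m) * norm x = 1/2 * (norm x + ?y m * (?y m * norm x))"
      by (simp add: power2_eq_square distrib_right)
    show ?case unfolding Y_eq y_eq by (rule mult_left_mono[OF *]) simp
  qed simp
  have Yn1: "norm (?Y m x) \<le> norm x" for m x
    using sqrt_iter_bound_range[of m]
    by (intro order_trans[OF Yn mult_left_le_one_le]) auto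
  \<comment> \<open>Uses V^2 - W^2 = V(V - W) + (V - W)W for consecutive iterates; the scalar
    recursion satisfies the same identity, so its increments majorize those of the
    operators.\<close>
  have Yd: "norm (?Y (Suc m) x - ?Y m x) \<le> (?y (Suc m) - ?y m) * norm x" for m x
  proof (induction m arbitrary: x)
    case 0
    then show ?case using Cn[of x] by simp
  next
    case (Suc m)
    define V W v w where "V = ?Y (Suc m)" and "W = ?Y m" and "v = ?y (Suc m)" and "w = ?y m"
    have IH: "norm (V x - W x) \<le> (v - w) * norm x" for x
      unfolding V_def W_def v_def w_def by (rule Suc)
    have VW: "norm (V x) \<le> v * norm x" "norm (W x) \<le> w * norm x" for x
      unfolding V_def W_def v_def w_def by (rule Yn)+
    have vw: "0 \<le> v" "0 \<le> v - w"
      using sqrt_iter_bound_range sqrt_iter_bound_mono unfolding v_def w_def diff_ge_0_iff_ge by blast+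
    have V: "V (x - y) = V x - V y" for x y unfolding V_def by (rule bop_simps[OF Y])
    have "?Y (Suc (Suc m)) x - ?Y (Suc m) x
        = scaleC (1/2) (C x + V (V x)) - scaleC (1/2) (C x + W (W x))"
      by (simp only: V_def W_def sqrt_iter.simps)
    also have "\<dots> = scaleC (1/2) (V (V x - W x) + (V (W x) - W (W x)))"
      unfolding cvs.scale_right_diff_distrib[symmetric] by (simp add: V)
    finally have "norm (?Y (Suc (Suc m)) x - ?Y (Suc m) x)
        = 1/2 * norm (V (V x - W x) + (V (W x) - W (W x)))"
      by (simp only: norm_scaleC) simp
    also have "\<dots> \<le> 1/2 * (norm (V (V x - W x)) + norm (V (W x) - W (W x)))"
      by (intro mult_left_mono norm_triangle_ineq) simp
    also have "norm (V (V x - W x)) \<le> v * ((v - w) * norm x)"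
      using VW(1) mult_left_mono[OF IH vw(1)] by (rule order_trans)
    also have "norm (V (W x) - W (W x)) \<le> (v - w) * (w * norm x)"
      using IH mult_left_mono[OF VW(2) vw(2)] by (rule order_trans)
    also have "1/2 * (v * ((v - w) * norm x) + (v - w) * (w * norm x)) = (1/2 * (v\<^sup>2 - w\<^sup>2)) * norm x"
      by (simp add: power2_eq_square algebra_simps)
    also have "1/2 * (v\<^sup>2 - w\<^sup>2) = ?y (Suc (Suc m)) - ?y (Suc m)"
      unfolding v_def w_def sqrt_iter_bound.simps(2)[of "Suc m"] by (simp add: field_simps)
    finally show ?case by simp
  qed
  \<comment> \<open>Telescoping. As the scalar sequence converges, the iterates are Cauchy at every
    vector.\<close>
  have Ydd: "norm (?Y (m + j) x - ?Y m x) \<le> (?y (m + j) - ?y m) * norm x" for m j x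
  proof (induction j)
    case (Suc j)
    have "norm (?Y (m + Suc j) x - ?Y m x)
        \<le> norm (?Y (Suc (m + j)) x - ?Y (m + j) x) + norm (?Y (m + j) x - ?Y m x)"
      using norm_triangle_ineq[of "?Y (Suc (m + j)) x - ?Y (m + j) x" "?Y (m + j) x - ?Y m x"]
      by simp
    also have "\<dots> \<le> (?y (Suc (m + j)) - ?y (m + j)) * norm x + (?y (m + j) - ?y m) * norm x"
      by (intro add_mono Yd Suc)
    also have "\<dots> = (?y (m + Suc j) - ?y m) * norm x"
      by (simp add: distrib_right[symmetric] del: sqrt_iter_bound.simps)
    finally show ?case .
  qed simp
  have "Cauchy (\<lambda>m. ?Y m x)" for x
  proof (rule metric_CauchyI)
    fix e :: real assume e: "0 < e"
    have "Cauchy ?y" using sqrt_iter_bound_convergent by (rule convergent_Cauchy)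
    moreover have "0 < e / (norm x + 1)" using e by (simp add: add_nonneg_pos)
    ultimately obtain N where N: "\<And>i j. N \<le> i \<Longrightarrow> N \<le> j \<Longrightarrow> dist (?y i) (?y j) < e / (norm x + 1)"
      unfolding Cauchy_def by blast
    have *: "dist (?Y (i + j) x) (?Y i x) < e" if "N \<le> i" for i j
    proof -
      have "dist (?Y (i + j) x) (?Y i x) \<le> (?y (i + j) - ?y i) * norm x"
        using Ydd by (simp add: dist_norm)
      also have "\<dots> \<le> e / (norm x + 1) * norm x"
        using N[of "i + j" i] that by (intro mult_right_mono) (auto simp: dist_real_def)
      also have "\<dots> < e"
      proof -
        have "0 < norm x + 1" by (simp add: add_nonneg_pos)
        moreover have "e * norm x < e * (norm x + 1)" using e by (simp add: distrib_left)
        ultimately show ?thesis by (simp add: pos_divide_less_eq)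
      qed
      finally show ?thesis .
    qed
    show "\<exists>N. \<forall>i\<ge>N. \<forall>j\<ge>N. dist (?Y i x) (?Y j x) < e"
    proof (intro exI allI impI)
      fix i j assume "N \<le> i" "N \<le> j"
      show "dist (?Y i x) (?Y j x) < e"
      proof (cases "i \<le> j")
        case True
        then show ?thesis using *[OF \<open>N \<le> i\<close>, of "j - i"] by (simp only: le_add_diff_inverse dist_commute)
      next
        case False
        then show ?thesis using *[OF \<open>N \<le> j\<close>, of "i - j"] by simp
      qed
    qed
  qed
  then have "\<exists>l. (\<lambda>m. ?Y m x) \<longlonglongrightarrow> l" for x
    unfolding convergent_def[symmetric] by (rule Cauchy_convergent)
  then obtain Z where Z: "\<And>x. (\<lambda>m. ?Y m x) \<longlonglongrightarrow> Z x" by metis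
  have Zn: "norm (Z x) \<le> norm x" for x
  proof (rule LIMSEQ_le_const2[OF tendsto_norm[OF Z]])
    show "\<exists>N. \<forall>n\<ge>N. norm (?Y n x) \<le> norm x" using Yn1 by blast
  qed
  have Zb: "bounded_clinear_op Z"
    unfolding bounded_clinear_op_def
  proof (intro conjI allI)
    show "Z (x + y) = Z x + Z y" for x y
    proof (rule LIMSEQ_unique[OF Z])
      show "(\<lambda>m. ?Y m (x + y)) \<longlonglongrightarrow> Z x + Z y"
        unfolding bop_simps(1)[OF Y] by (rule tendsto_add[OF Z Z])
    qed
    show "Z (scaleC c x) = scaleC c (Z x)" for c x
    proof (rule LIMSEQ_unique[OF Z])
      show "(\<lambda>m. ?Y m (scaleC c x)) \<longlonglongrightarrow> scaleC c (Z x)"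
        unfolding bop_scaleC[OF Y] by (rule bounded_linear.tendsto[OF bounded_linear_scaleC Z])
    qed
    show "\<exists>K. \<forall>x. norm (Z x) \<le> K * norm x" using Zn by (intro exI[of _ 1]) simp
  qed
  have commY: "X (?Y m x) = ?Y m (X x)" if "bounded_clinear_op X" "\<And>x. X (C x) = C (X x)" for X m x
    by (induction m arbitrary: x) (simp_all add: bop_simps[OF that(1)] that(2))
  have commZ: "X (Z x) = Z (X x)" if "bounded_clinear_op X" "\<And>x. X (C x) = C (X x)" for X x
  proof (rule LIMSEQ_unique)
    show "(\<lambda>m. ?Y m (X x)) \<longlonglongrightarrow> X (Z x)"
      using bounded_linear.tendsto[OF bounded_clinear_op_bounded_linear[OF that(1)] Z[of x]]
      by (simp only: commY[OF that])
  qed (rule Z)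
  have ZZ: "scaleC 2 (Z x) = C x + Z (Z x)" for x
  proof -
    \<comment> \<open>The outer operator varies with \<open>m\<close> too; the uniform bound
      \<open>Yn1\<close> lets the inner argument be replaced by its limit first.\<close>
    have "(\<lambda>m. ?Y m (?Y m x)) \<longlonglongrightarrow> Z (Z x)"
    proof -
      have "(\<lambda>m. ?Y m (?Y m x) - ?Y m (Z x)) \<longlonglongrightarrow> 0"
      proof (rule Lim_null_comparison)
        show "\<forall>\<^sub>F m in sequentially. norm (?Y m (?Y m x) - ?Y m (Z x)) \<le> norm (?Y m x - Z x)"
        proof (intro always_eventually allI)
          fix m
          show "norm (?Y m (?Y m x) - ?Y m (Z x)) \<le> norm (?Y m x - Z x)"
            using Yn1[of m "?Y m x - Z x"] by (simp only: bop_simps[OF Y])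
        qed
        show "(\<lambda>m. norm (?Y m x - Z x)) \<longlonglongrightarrow> 0"
          using Z[of x] by (simp add: LIM_zero tendsto_norm_zero)
      qed
      from tendsto_add[OF this Z[of "Z x"]] show ?thesis by simp
    qed
    then have "(\<lambda>m. ?Y (Suc m) x) \<longlonglongrightarrow> scaleC (1/2) (C x + Z (Z x))"
      by (auto intro!: bounded_linear.tendsto[OF bounded_linear_scaleC] tendsto_add)
    moreover have "(\<lambda>m. ?Y (Suc m) x) \<longlonglongrightarrow> Z x" by (rule LIMSEQ_Suc[OF Z])
    ultimately have "Z x = scaleC (1/2) (C x + Z (Z x))" by (metis LIMSEQ_unique)
    then show ?thesis by (metis cvs.scale_scale mult_2 nonzero_mult_div_cancel_left one_add_one scaleC_one
          times_divide_eq_right zero_neq_numeral)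
  qed
  have Csa: "cinner (C x) y = cinner x (C y)" for x y
    by (simp add: C_def cinner_simps positive_op_self_adjoint[OF A])
  have Ysa: "cinner (?Y m x) y = cinner x (?Y m y)" for m x y
    by (induction m arbitrary: x y) (simp_all add: cinner_simps Csa)
  have Zsa: "cinner (Z x) y = cinner x (Z y)" for x y
    by (rule LIMSEQ_unique[OF tendsto_cinner[OF Z tendsto_const]])
      (simp add: Ysa tendsto_cinner[OF tendsto_const Z])
  define B where "B = (\<lambda>x. x - Z x)"
  have "bounded_clinear_op B" unfolding B_def by (intro bop_diff bop_id Zb)
  moreover have "Im (cinner (B x) x) = 0" for x
    using arg_cong[OF cinner_commute[of "Z x" x], of Im] Zsa[of x x]
    by (simp add: B_def cinner_simps cinner_same)
  moreover have "0 \<le> Re (cinner (B x) x)" for x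
  proof -
    have "Re (cinner (Z x) x) \<le> norm (Z x) * norm x"
      using complex_Re_le_cmod cauchy_schwarz order_trans by blast
    also have "\<dots> \<le> (norm x)\<^sup>2" using Zn[of x] by (simp add: power2_eq_square mult_right_mono)
    finally show ?thesis by (simp add: B_def cinner_simps cinner_same)
  qed
  ultimately have "positive_op B" by (simp add: positive_op_def)
  moreover have "B \<circ> B = A"
  proof
    fix x
    have "scaleC 2 (Z x) = Z x + Z x"
      by (metis cvs.scale_left_distrib one_add_one scaleC_one)
    then show "(B \<circ> B) x = A x"
      using ZZ[of x] by (simp add: B_def C_def bop_simps[OF Zb] algebra_simps)
  qed
  \<comment> \<open>Commutation passes from \<open>A\<close> to \<open>C\<close>, to the iterates
    and to their limit. The uniqueness of the root rests on this clause.\<close>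
  moreover have "X (B x) = B (X x)" if "bounded_clinear_op X" "\<forall>x. X (A x) = A (X x)" for X x
  proof -
    have "X (C x) = C (X x)" for x using that(2) by (simp add: C_def bop_simps[OF that(1)])
    then show ?thesis using commZ[OF that(1)] by (simp add: B_def bop_simps[OF that(1)])
  qed
  ultimately show ?thesis by blast
qed

text \<open>If \<open>B\<close> and \<open>B'\<close> are positive roots, \<open>B\<close> commuting with \<open>B'\<close>, and \<open>D = B - B'\<close>, then
  \<open>D B D + D B' D = (B\<^sup>2 - B'\<^sup>2) D = 0\<close> forces both summands to vanish, hence \<open>D\<^sup>3 = 0\<close>.\<close>

lemma op_sqrt_properties:
  fixes A :: "'a::chilbert_space \<Rightarrow> 'a"
  assumes A: "positive_op A" and A1: "\<And>x. norm (x - A x) \<le> norm x"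
  shows "positive_op (op_sqrt A)" "op_sqrt A (op_sqrt A x) = A x"
proof -
  obtain B where B: "positive_op B" and BB: "B \<circ> B = A"
    and comm: "\<And>X x. bounded_clinear_op X \<Longrightarrow> \<forall>x. X (A x) = A (X x) \<Longrightarrow> X (B x) = B (X x)"
    using positive_sqrt_exists[OF A A1] by blast
  have unique: "B' = B" if B': "positive_op B'" and BB': "B' \<circ> B' = A" for B'
  proof
    fix x
    have b: "bounded_clinear_op B" and b': "bounded_clinear_op B'"
      using B B' by (auto simp: positive_op_def)
    \<comment> \<open>Any root commutes with its own square \<open>A\<close>, and therefore with the
      constructed root \<open>B\<close>.\<close>
    have "B' (A x) = A (B' x)" for x using BB' by (metis comp_apply)
    then have cm: "B' (B x) = B (B' x)" for x using comm[OF b'] by blast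
    have sq: "B (B x) = B' (B' x)" for x using BB BB' by (metis comp_apply)
    define D where "D = (\<lambda>x. B x - B' x)"
    have D: "cinner (D x) y = cinner x (D y)" for x y
      by (simp add: D_def cinner_simps positive_op_self_adjoint[OF B] positive_op_self_adjoint[OF B'])
    have sum0: "B (D x) + B' (D x) = 0" for x
      by (simp add: D_def bop_simps[OF b] bop_simps[OF b'] cm sq)
    have both: "B (D x) = 0 \<and> B' (D x) = 0" for x
    proof -
      have "Re (cinner (B (D x)) (D x)) + Re (cinner (B' (D x)) (D x)) = 0"
        using arg_cong[OF sum0[of x], of "\<lambda>z. Re (cinner z (D x))"] by (simp add: cinner_simps)
      moreover have "0 \<le> Re (cinner (B (D x)) (D x))" "0 \<le> Re (cinner (B' (D x)) (D x))"
        using B B' by (auto simp: positive_op_def)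
      ultimately show ?thesis using positive_op_kernel[OF B] positive_op_kernel[OF B'] by force
    qed
    \<comment> \<open>By \<open>both\<close>, \<open>D\<close> vanishes on the range of
      \<open>D\<close>; self-adjointness moves one \<open>D\<close> to the other side.\<close>
    then have "cinner (D x) (D x) = 0" unfolding D by (simp add: D_def)
    then show "B' x = B x" by (simp add: cinner_eq_zero_iff D_def)
  qed
  have root: "op_sqrt A = B" unfolding op_sqrt_def
    by (rule the_equality) (use B BB unique in blast)+
  show "positive_op (op_sqrt A)" unfolding root by (rule B)
  show "op_sqrt A (op_sqrt A x) = A x" unfolding root using fun_cong[OF BB, of x] by simp
qed

subsection \<open>Contractions and their defect spaces\<close>

lemma contraction_bop: "contraction T \<Longrightarrow> bounded_clinear_op T"
  by (simp add: contraction_def)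

lemma contraction_adj:
  fixes T :: "'a::chilbert_space \<Rightarrow> 'a"
  assumes "contraction T" shows "contraction (adj T)"
  using assms adj_bound[of T 1] bop_adj[of T] by (simp add: contraction_def)

lemma contraction_comp: "contraction A \<Longrightarrow> contraction B \<Longrightarrow> contraction (\<lambda>x. A (B x))"
  using bop_comp[of A B] unfolding contraction_def by (metis order_trans)

lemma contraction_funpow: "contraction A \<Longrightarrow> contraction (A ^^ r)"
proof (induction r)
  case 0
  show ?case by (simp add: contraction_def bop_id id_def)
next
  case (Suc r)
  then show ?case using contraction_comp[of A "A ^^ r"] by (simp add: comp_def)
qed

lemma cinner_adj_self:
  fixes T :: "'a::chilbert_space \<Rightarrow> 'a"
  assumes "bounded_clinear_op T"
  shows "cinner (x - adj T (T x)) x = complex_of_real ((norm x)\<^sup>2 - (norm (T x))\<^sup>2)"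
  by (simp add: cinner_simps cinner_adj_left[OF assms] cinner_same)

lemma positive_defect:
  fixes T :: "'a::chilbert_space \<Rightarrow> 'a"
  assumes T: "contraction T"
  shows "positive_op (\<lambda>x. x - adj T (T x))"
  unfolding positive_op_def
proof (intro conjI allI)
  have b: "bounded_clinear_op T" using T by (rule contraction_bop)
  show "bounded_clinear_op (\<lambda>x. x - adj T (T x))"
    by (rule bop_diff[OF bop_id bop_comp[OF bop_adj[OF b] b]])
  have "norm (T x) \<le> norm x" for x using T by (simp add: contraction_def)
  then show "Im (cinner (x - adj T (T x)) x) = 0" "0 \<le> Re (cinner (x - adj T (T x)) x)" for x
    unfolding cinner_adj_self[OF b] Im_complex_of_real Re_complex_of_real
    by (simp_all only: diff_ge_0_iff_ge power_mono norm_ge_zero)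
qed

text \<open>The form of the positive operator I - T*T at \<open>x\<close> is |x|^2 - |Tx|^2, so
  equality of norms puts \<open>x\<close> in its kernel. This turns norm conditions into linear
  equations.\<close>

lemma contraction_norm_eq_iff:
  fixes T :: "'a::chilbert_space \<Rightarrow> 'a"
  assumes T: "contraction T"
  shows "norm (T x) = norm x \<longleftrightarrow> adj T (T x) = x"
proof
  have b: "bounded_clinear_op T" using T by (rule contraction_bop)
  show "adj T (T x) = x" if "norm (T x) = norm x"
    using positive_op_kernel[OF positive_defect[OF T], of x] that cinner_adj_self[OF b, of x]
    by simp
  show "norm (T x) = norm x" if "adj T (T x) = x"
    using cinner_adj_self[OF b, of x] that by (simp add: power2_eq_iff_nonneg flip: of_real_diff of_real_power)
qed

lemma defect_op_properties:
  fixes T :: "'a::chilbert_space \<Rightarrow> 'a"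
  assumes T: "contraction T"
  shows "positive_op (defect_op T)" "defect_op T (defect_op T x) = x - adj T (T x)"
proof -
  have "norm (x - (x - adj T (T x))) \<le> norm x" for x
    using contraction_comp[OF contraction_adj[OF T] T] by (simp add: contraction_def)
  from op_sqrt_properties[OF positive_defect[OF T] this]
  show "positive_op (defect_op T)" "defect_op T (defect_op T x) = x - adj T (T x)"
    by (simp_all add: defect_op_def)
qed

lemma norm_defect_op_sq:
  fixes T :: "'a::chilbert_space \<Rightarrow> 'a"
  assumes T: "contraction T"
  shows "(norm (defect_op T x))\<^sup>2 = (norm x)\<^sup>2 - (norm (T x))\<^sup>2"
proof -
  have "complex_of_real ((norm (defect_op T x))\<^sup>2) = complex_of_real ((norm x)\<^sup>2 - (norm (T x))\<^sup>2)"
    unfolding cinner_same[symmetric] positive_op_self_adjoint[OF defect_op_properties(1)[OF T], symmetric]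
      defect_op_properties(2)[OF T] by (rule cinner_adj_self[OF contraction_bop[OF T]])
  then show ?thesis unfolding of_real_eq_iff .
qed

text \<open>The closed range of a self-adjoint operator is the complement of its kernel, and |D x|^2
  = |x|^2 - |Tx|^2 identifies the kernel of the defect operator.\<close>

lemma defect_space_eq:
  fixes T :: "'a::chilbert_space \<Rightarrow> 'a"
  assumes T: "contraction T"
  shows "defect_space T = orth_compl {x. adj T (T x) = x}"
proof -
  have D: "positive_op (defect_op T)" by (rule defect_op_properties(1)[OF T])
  then have b: "bounded_clinear_op (defect_op T)" by (simp add: positive_op_def)
  have "cvs.subspace (range (defect_op T))"
    using module_hom.subspace_image[OF bounded_clinear_op_module_hom[OF b]
        cvs.subspace_UNIV] .
  moreover have "orth_compl (range (defect_op T)) = {x. adj T (T x) = x}"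
  proof -
    have "x \<in> orth_compl (range (defect_op T)) \<longleftrightarrow> defect_op T x = 0" for x
    proof -
      have "x \<in> orth_compl (range (defect_op T)) \<longleftrightarrow> (\<forall>y. cinner (defect_op T x) y = 0)"
        unfolding orth_compl_def positive_op_self_adjoint[OF D] by auto
      then show ?thesis using cinner_eqI[of "defect_op T x" 0] by auto
    qed
    moreover have "defect_op T x = 0 \<longleftrightarrow> adj T (T x) = x" for x
    proof -
      have "defect_op T x = 0 \<longleftrightarrow> (norm (defect_op T x))\<^sup>2 = 0" by simp
      also have "\<dots> \<longleftrightarrow> (norm (T x))\<^sup>2 = (norm x)\<^sup>2"
        unfolding norm_defect_op_sq[OF T] by auto
      also have "\<dots> \<longleftrightarrow> norm (T x) = norm x"
        by (rule power2_eq_iff_nonneg) simp_all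
      finally show ?thesis unfolding contraction_norm_eq_iff[OF T] .
    qed
    ultimately show ?thesis by blast
  qed
  ultimately have "orth_compl {x. adj T (T x) = x} = closure (range (defect_op T))"
    using orth_compl_orth_compl[of "range (defect_op T)"] by simp
  then show ?thesis by (simp add: defect_space_def)
qed

section \<open>The unitary part of a contraction\<close>

lemma funpow_norm_fixed:
  assumes "\<And>x. x \<in> M \<Longrightarrow> T x \<in> M" "\<And>x. x \<in> M \<Longrightarrow> norm (T x) = norm x" "x \<in> M"
  shows "(T ^^ r) x \<in> M \<and> norm ((T ^^ r) x) = norm (x::'a::real_normed_vector)"
  using assms by (induction r) auto

text \<open>The set \<open>M\<close> of vectors whose norm is kept by all powers of \<open>T\<close>
  and \<open>adj T\<close> is the largest reducing subspace on which \<open>T\<close> is unitary, so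
  \<open>T\<close> is completely non-unitary exactly when \<open>M\<close> is trivial.\<close>

lemma completely_non_unitary_iff:
  fixes T :: "'a::chilbert_space \<Rightarrow> 'a"
  assumes T: "contraction T"
  shows "completely_non_unitary T \<longleftrightarrow>
    (\<forall>x. (\<forall>r\<ge>1. norm ((T ^^ r) x) = norm x \<and> norm ((adj T ^^ r) x) = norm x) \<longrightarrow> x = 0)"
proof -
  have b: "bounded_clinear_op T" using T by (rule contraction_bop)
  have b': "bounded_clinear_op (adj T)" using b by (rule bop_adj)
  note T' = contraction_adj[OF T]
  define M where "M = {x. \<forall>r. norm ((T ^^ r) x) = norm x \<and> norm ((adj T ^^ r) x) = norm x}"
  have M_iff: "x \<in> M \<longleftrightarrow> (\<forall>r\<ge>1. norm ((T ^^ r) x) = norm x \<and> norm ((adj T ^^ r) x) = norm x)" for x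
  proof
    assume *: "\<forall>r\<ge>1. norm ((T ^^ r) x) = norm x \<and> norm ((adj T ^^ r) x) = norm x"
    have "norm ((T ^^ r) x) = norm x \<and> norm ((adj T ^^ r) x) = norm x" for r
      using * by (cases "r = 0") auto
    then show "x \<in> M" by (simp add: M_def)
  qed (simp add: M_def)
  have Mn: "norm ((T ^^ r) x) = norm x" "norm ((adj T ^^ r) x) = norm x" if "x \<in> M" for x r
    using that by (auto simp: M_def)
  have TT: "adj T (T x) = x" if "x \<in> M" for x
    using Mn(1)[OF that, of 1] contraction_norm_eq_iff[OF T] by simp
  have TT': "T (adj T x) = x" if "x \<in> M" for x
    using Mn(2)[OF that, of 1] contraction_norm_eq_iff[OF T'] by (simp add: adj_adj[OF b])
  \<comment> \<open>For powers of \<open>adj T\<close> one factor cancels against \<open>T\<close>,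
    because \<open>adj T (T x) = x\<close> on \<open>M\<close>; this is why the exponent is written
    as a successor.\<close>
  have inv: "T x \<in> M" if "x \<in> M" for x
    unfolding M_iff
  proof (intro allI impI conjI)
    fix r :: nat assume "1 \<le> r"
    then obtain s where r: "r = Suc s" by (cases r) auto
    show "norm ((T ^^ r) (T x)) = norm (T x)"
      using Mn(1)[OF that, of "Suc r"] Mn(1)[OF that, of 1] by (simp only: funpow_Suc_right o_apply) simp
    show "norm ((adj T ^^ r) (T x)) = norm (T x)"
      using Mn(2)[OF that, of s] Mn(1)[OF that, of 1] TT[OF that]
      by (simp add: r funpow_Suc_right del: funpow.simps(2))
  qed
  have inv': "adj T x \<in> M" if "x \<in> M" for x
    unfolding M_iff
  proof (intro allI impI conjI)
    fix r :: nat assume "1 \<le> r"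
    then obtain s where r: "r = Suc s" by (cases r) auto
    show "norm ((adj T ^^ r) (adj T x)) = norm (adj T x)"
      using Mn(2)[OF that, of "Suc r"] Mn(2)[OF that, of 1] by (simp only: funpow_Suc_right o_apply) simp
    show "norm ((T ^^ r) (adj T x)) = norm (adj T x)"
      using Mn(1)[OF that, of s] Mn(2)[OF that, of 1] TT'[OF that]
      by (simp add: r funpow_Suc_right del: funpow.simps(2))
  qed
  \<comment> \<open>As an intersection of fixed-point sets of bounded operators, \<open>M\<close> is
    a closed subspace, which its description by norms does not show.\<close>
  have M_fix: "M = (\<Inter>r. {x. (adj T ^^ r) ((T ^^ r) x) = x} \<inter> {x. (T ^^ r) ((adj T ^^ r) x) = x})"
    using contraction_norm_eq_iff[OF contraction_funpow[OF T]]
      contraction_norm_eq_iff[OF contraction_funpow[OF T']]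
    by (auto simp: M_def adj_funpow[OF b] adj_funpow[OF b'] adj_adj[OF b])
  have fixsub: "cvs.subspace {x. G x = x} \<and> closed {x. G x = x}"
    if G: "bounded_clinear_op G" for G :: "'a \<Rightarrow> 'a"
  proof
    show "cvs.subspace {x. G x = x}" by (simp add: cvs.subspace_def bop_simps[OF G])
    show "closed {x. G x = x}"
      by (intro closed_Collect_eq linear_continuous_on bounded_clinear_op_bounded_linear G
          continuous_intros)
  qed
  have "cvs.subspace M" unfolding M_fix
    using fixsub[OF bop_comp[OF bop_funpow[OF b] bop_funpow[OF b']]]
      fixsub[OF bop_comp[OF bop_funpow[OF b'] bop_funpow[OF b]]]
    by (intro cvs.subspace_Inter) (auto intro!: cvs.subspace_inter)
  moreover have "closed M" unfolding M_fix
    using fixsub[OF bop_comp[OF bop_funpow[OF b] bop_funpow[OF b']]]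
      fixsub[OF bop_comp[OF bop_funpow[OF b'] bop_funpow[OF b]]]
    by (intro closed_INT ballI closed_Int) auto
  ultimately have red: "reducing_subspace T M"
    using inv inv' by (auto simp: reducing_subspace_def csubspace_eq_subspace)
  have uni: "unitary_on T M"
    unfolding unitary_on_def
  proof (intro conjI ballI)
    show "norm (T x) = norm x" if "x \<in> M" for x using Mn(1)[OF that, of 1] by simp
    have "x \<in> T ` M" if "x \<in> M" for x
      using TT'[OF that] inv'[OF that] by (metis imageI)
    then show "T ` M = M" using inv by blast
  qed
  have max: "N \<subseteq> M" if N: "reducing_subspace T N" "unitary_on T N" for N
  proof
    fix x assume x: "x \<in> N"
    have Tn: "norm (T y) = norm y" if "y \<in> N" for y using N(2) that by (simp add: unitary_on_def)
    have Tn': "norm (adj T y) = norm y" if "y \<in> N" for y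
    proof -
      \<comment> \<open>Surjectivity of \<open>T\<close> on \<open>N\<close> is what makes
        \<open>adj T\<close> isometric there: with y = T z, \<open>adj T y\<close> is
        \<open>z\<close>.\<close>
      have "y \<in> T ` N" using N(2) that by (simp add: unitary_on_def)
      then obtain z where z: "z \<in> N" "y = T z" by blast
      then show ?thesis using Tn contraction_norm_eq_iff[OF T] by metis
    qed
    have "T y \<in> N" "adj T y \<in> N" if "y \<in> N" for y
      using N(1) that by (auto simp: reducing_subspace_def)
    then show "x \<in> M" unfolding M_def
      using funpow_norm_fixed[of N T] funpow_norm_fixed[of N "adj T"] Tn Tn' x by blast
  qed
  have "0 \<in> M" using \<open>cvs.subspace M\<close> by (rule cvs.subspace_0)
  have "completely_non_unitary T \<longleftrightarrow> M \<subseteq> {0}"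
  proof
    assume "completely_non_unitary T"
    then show "M \<subseteq> {0}" using red uni unfolding completely_non_unitary_def by blast
  next
    assume M0: "M \<subseteq> {0}"
    show "completely_non_unitary T"
      unfolding completely_non_unitary_def
    proof (intro notI, elim exE conjE)
      fix N assume N: "reducing_subspace T N" "N \<noteq> {0}" "unitary_on T N"
      then have "N \<subseteq> {0}" using max M0 by blast
      moreover have "0 \<in> N" using N(1) by (simp add: reducing_subspace_def csubspace_def)
      ultimately show False using N(2) by blast
    qed
  qed
  then show ?thesis using M_iff by blast
qed

subsection \<open>Dimension\<close>

lemma has_cdim_eq:
  "has_cdim V m \<longleftrightarrow> (\<exists>B\<subseteq>V. finite B \<and> card B = m \<and> cvs.independent B \<and> cvs.span B = V)"
  unfolding has_cdim_def cindependent_eq cspan_eq_span by blast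

lemma has_cdim_image:
  assumes "module_hom scaleC scaleC A" "inj_on A V" "has_cdim V m"
  shows "has_cdim (A ` V) m"
proof -
  interpret A: module_hom scaleC scaleC A by fact
  obtain B where B: "B \<subseteq> V" "finite B" "card B = m" "cvs.independent B" "cvs.span B = V"
    using assms(3) unfolding has_cdim_eq by blast
  show ?thesis
    unfolding has_cdim_eq
  proof (intro exI[of _ "A ` B"] conjI)
    show "card (A ` B) = m" using B assms(2) by (metis card_image inj_on_subset)
    show "cvs.independent (A ` B)"
      using A.independent_injective_image[OF B(4)] assms(2) B(5) by simp
    show "cvs.span (A ` B) = A ` V" using A.span_image[of B] B(5) by simp
  qed (use B in auto)
qed

text \<open>A vector of \<open>W\<close> outside \<open>V\<close> would extend a basis of
  \<open>V\<close> to an independent set of m + 1 vectors in the span of \<open>m\<close>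
  vectors.\<close>

lemma has_cdim_subset_eq:
  assumes "has_cdim V m" "has_cdim W m" "V \<subseteq> W"
  shows "V = W"
proof (rule ccontr)
  assume "V \<noteq> W"
  then obtain w where w: "w \<in> W" "w \<notin> V" using assms(3) by blast
  obtain B where B: "finite B" "card B = m" "cvs.independent B" "cvs.span B = V"
    using assms(1) unfolding has_cdim_eq by blast
  obtain C where C: "finite C" "card C = m" "cvs.span C = W"
    using assms(2) unfolding has_cdim_eq by blast
  have "B \<subseteq> V" using B(4) cvs.span_superset by blast
  have "cvs.independent (insert w B)" using B(3,4) w(2) by (simp add: cvs.independent_insert)
  moreover have "insert w B \<subseteq> cvs.span C" using \<open>B \<subseteq> V\<close> assms(3) w(1) C(3) by blast
  ultimately have "card (insert w B) \<le> card C" using cvs.independent_span_bound[OF C(1)] by blast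
  moreover have "w \<notin> B" using \<open>B \<subseteq> V\<close> w(2) by blast
  ultimately show False using B(1,2) C(2) by simp
qed

lemma fin_cdim_span:
  assumes "finite S" shows "fin_cdim (cvs.span S)"
proof -
  obtain B where B: "B \<subseteq> S" "cvs.independent B" "S \<subseteq> cvs.span B"
    using cvs.maximal_independent_subset[of S] by blast
  then have "cvs.span B = cvs.span S"
    by (meson cvs.span_eq cvs.span_superset subset_trans)
  then show ?thesis
    unfolding fin_cdim_def has_cdim_eq using B assms finite_subset cvs.span_superset by metis
qed

text \<open>The index set is a parameter so that finite families, indexed by an initial segment, and
  whole sequences are treated alike; values outside it are unconstrained.\<close>

definition orthonormal_on :: "nat set \<Rightarrow> (nat \<Rightarrow> 'a::complex_inner) \<Rightarrow> bool" where
  "orthonormal_on I u \<longleftrightarrow> (\<forall>i\<in>I. \<forall>j\<in>I. cinner (u i) (u j) = (if i = j then 1 else 0))"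

lemma orthonormal_onD:
  "orthonormal_on I u \<Longrightarrow> i \<in> I \<Longrightarrow> j \<in> I \<Longrightarrow> cinner (u i) (u j) = (if i = j then 1 else 0)"
  by (simp add: orthonormal_on_def)

lemma orthonormal_has_cdim:
  assumes u: "orthonormal_on {..<m} u"
  shows "has_cdim (cvs.span (u ` {..<m})) m"
proof -
  have inj: "inj_on u {..<m}"
    by (rule inj_onI) (metis orthonormal_onD[OF u] one_neq_zero)
  have "cvs.independent (u ` {..<m})"
    unfolding cvs.independent_explicit_module
  proof (intro allI impI)
    fix t c v
    assume t: "finite t" "t \<subseteq> u ` {..<m}" and sum: "(\<Sum>v\<in>t. scaleC (c v) v) = 0" and v: "v \<in> t"
    have o: "cinner w v = (if w = v then 1 else 0)" if w: "w \<in> t" for w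
    proof -
      obtain i j where ij: "i < m" "j < m" "w = u i" "v = u j" using w v t by blast
      then have "i = j \<longleftrightarrow> w = v" using inj by (auto simp: inj_on_def)
      then show ?thesis using orthonormal_onD[OF u, of i j] ij by simp
    qed
    have "0 = cinner (\<Sum>v\<in>t. scaleC (c v) v) v" using sum by simp
    also have "\<dots> = (\<Sum>w\<in>t. if w = v then c w else 0)"
      unfolding cinner_sum_left cinner_scaleC_left by (intro sum.cong) (auto simp: o)
    also have "\<dots> = c v" using v t(1) by simp
    finally show "c v = 0" by simp
  qed
  then show ?thesis
    unfolding has_cdim_eq using card_image[OF inj]
    by (intro exI[of _ "u ` {..<m}"] conjI cvs.span_superset) auto
qed

text \<open>In the induction step the new vector loses its projection \<open>p\<close> to the
  earlier span, is normalized, and is stored at the next free index \<open>card B\<close>.\<close>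

lemma gram_schmidt:
  assumes "finite B" "cvs.independent (B :: 'a::complex_inner set)"
  shows "\<exists>u. orthonormal_on {..<card B} u \<and> cvs.span (u ` {..<card B}) = cvs.span B"
  using assms
proof (induction B rule: finite_induct)
  case empty
  show ?case by (simp add: orthonormal_on_def)
next
  case (insert b B)
  let ?m = "card B"
  have "cvs.independent B" and b: "b \<notin> cvs.span B"
    using insert.prems insert.hyps(2) by (simp_all add: cvs.independent_insert)
  then obtain u where u: "orthonormal_on {..<?m} u" and span: "cvs.span (u ` {..<?m}) = cvs.span B"
    using insert.IH by blast
  define p where "p = (\<Sum>i<?m. scaleC (cinner b (u i)) (u i))"
  define w where "w = b - p"
  have uB: "u i \<in> cvs.span B" if "i < ?m" for i
    using that cvs.span_superset[of "u ` {..<?m}"] span by blast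
  then have p: "p \<in> cvs.span B"
    unfolding p_def by (intro cvs.span_sum cvs.span_scale) auto
  then have "w \<noteq> 0" using b by (auto simp: w_def)
  then have nw: "norm w \<noteq> 0" by simp
  have wu: "cinner w (u i) = 0" if i: "i < ?m" for i
  proof -
    have "cinner p (u i) = (\<Sum>j<?m. if j = i then cinner b (u j) else 0)"
      unfolding p_def cinner_sum_left cinner_scaleC_left
      using i by (intro sum.cong) (auto simp: orthonormal_onD[OF u])
    also have "\<dots> = cinner b (u i)" using i by simp
    finally show ?thesis by (simp add: w_def cinner_diff_left)
  qed
  define v where "v = scaleC (inverse (complex_of_real (norm w))) w"
  have "norm v = 1" using nw by (simp add: v_def norm_inverse)
  then have vv: "cinner v v = 1" by (simp add: cinner_same)
  have vu: "cinner v (u i) = 0" "cinner (u i) v = 0" if "i < ?m" for i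
    using wu[OF that] cinner_zero_commute[of w "u i"] by (simp_all add: v_def cinner_simps)
  have wv: "w = scaleC (complex_of_real (norm w)) v"
    using nw by (simp add: v_def scaleC_one)
  define u' where "u' = u(?m := v)"
  have u'_image: "u' ` {..<Suc ?m} = insert v (u ` {..<?m})"
    by (auto simp: u'_def lessThan_Suc)
  have "orthonormal_on {..<Suc ?m} u'"
    using orthonormal_onD[OF u] vu vv
    by (auto simp: orthonormal_on_def u'_def less_Suc_eq)
  moreover have "cvs.span (insert v (u ` {..<?m})) = cvs.span (insert b B)"
    unfolding cvs.span_eq
  proof
    have sub: "cvs.span B \<subseteq> cvs.span (insert b B)" by (intro cvs.span_mono) auto
    have "b \<in> cvs.span (insert b B)" by (rule cvs.span_base) simp
    then have "v \<in> cvs.span (insert b B)"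
      using p sub unfolding v_def w_def by (intro cvs.span_scale cvs.span_diff) auto
    then show "insert v (u ` {..<?m}) \<subseteq> cvs.span (insert b B)" using uB sub by auto
    have sub': "cvs.span B \<subseteq> cvs.span (insert v (u ` {..<?m}))"
      unfolding span[symmetric] by (intro cvs.span_mono) auto
    have "v \<in> cvs.span (insert v (u ` {..<?m}))" by (rule cvs.span_base) simp
    then have "w \<in> cvs.span (insert v (u ` {..<?m}))" using wv cvs.span_scale by metis
    then have "w + p \<in> cvs.span (insert v (u ` {..<?m}))" using p sub' by (intro cvs.span_add) auto
    then have "b \<in> cvs.span (insert v (u ` {..<?m}))" by (simp add: w_def)
    then show "insert b B \<subseteq> cvs.span (insert v (u ` {..<?m}))"
      using sub' cvs.span_superset[of B] by blast
  qed
  ultimately show ?case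
    using insert.hyps by (intro exI[of _ u']) (simp add: u'_image)
qed

lemma has_cdim_orthonormal:
  assumes "has_cdim (V :: 'a::complex_inner set) m"
  obtains u where "orthonormal_on {..<m} u" "cvs.span (u ` {..<m}) = V"
proof -
  obtain B where "finite B" "card B = m" "cvs.independent B" "cvs.span B = V"
    using assms unfolding has_cdim_eq by blast
  then show thesis using gram_schmidt[of B] that by blast
qed

lemma orth_compl_span: "orth_compl (cvs.span B) = orth_compl (B :: 'a::complex_inner set)"
proof
  show "orth_compl (cvs.span B) \<subseteq> orth_compl B"
    using cvs.span_superset[of B] by (auto simp: orth_compl_def)
  show "orth_compl B \<subseteq> orth_compl (cvs.span B)"
  proof
    fix x assume "x \<in> orth_compl B"
    then have "B \<subseteq> orth_compl {x}" by (auto simp: orth_compl_def cinner_zero_commute)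
    then have "cvs.span B \<subseteq> orth_compl {x}" by (rule cvs.span_minimal[OF _ subspace_orth_compl])
    then show "x \<in> orth_compl (cvs.span B)" by (auto simp: orth_compl_def cinner_zero_commute)
  qed
qed

lemma orth_compl_closure: "orth_compl (closure M) = orth_compl (M :: 'a::complex_inner set)"
proof
  show "orth_compl (closure M) \<subseteq> orth_compl M"
    using closure_subset[of M] by (auto simp: orth_compl_def)
  show "orth_compl M \<subseteq> orth_compl (closure M)"
  proof
    fix x assume "x \<in> orth_compl M"
    then have "M \<subseteq> orth_compl {x}" by (auto simp: orth_compl_def cinner_zero_commute)
    then have "closure M \<subseteq> orth_compl {x}" by (rule closure_minimal[OF _ closed_orth_compl])
    then show "x \<in> orth_compl (closure M)" by (auto simp: orth_compl_def cinner_zero_commute)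
  qed
qed

lemma orth_compl_UNIV: "orth_compl UNIV = {0 :: 'a::complex_inner}"
proof (intro equalityI subsetI)
  fix x :: 'a assume "x \<in> orth_compl UNIV"
  then have "cinner x x = 0" by (simp add: orth_compl_def)
  then show "x \<in> {0}" by (simp add: cinner_eq_zero_iff)
qed (simp add: orth_compl_def)

lemma orth_compl_zero: "orth_compl {0} = UNIV"
  by (simp add: orth_compl_def)

text \<open>Density of the span is equivalent to a trivial complement by the double complement
  theorem; the second form is the one that complete non-unitarity delivers.\<close>

lemma orthonormal_basis_iff:
  fixes e :: "nat \<Rightarrow> 'a::chilbert_space"
  shows "orthonormal_basis e \<longleftrightarrow> orthonormal_on UNIV e \<and> orth_compl (range e) = {0}"
proof -
  have "closure (cvs.span (range e)) = UNIV \<longleftrightarrow> orth_compl (range e) = {0}"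
  proof
    assume "closure (cvs.span (range e)) = UNIV"
    then have "orth_compl (range e) = orth_compl UNIV"
      using orth_compl_closure[of "cvs.span (range e)"] orth_compl_span[of "range e"] by simp
    also have "\<dots> = {0}" by (rule orth_compl_UNIV)
    finally show "orth_compl (range e) = {0}" .
  next
    assume "orth_compl (range e) = {0}"
    then show "closure (cvs.span (range e)) = UNIV"
      using orth_compl_orth_compl[OF cvs.subspace_span, of "range e"] orth_compl_span[of "range e"]
      by (simp add: orth_compl_zero)
  qed
  then show ?thesis
    unfolding orthonormal_basis_def orthonormal_on_def cspan_eq_span by simp
qed

subsection \<open>Expansions in an orthonormal basis\<close>

instance chilbert_space \<subseteq> banach ..

locale onb =
  fixes e :: "nat \<Rightarrow> 'a::chilbert_space"
  assumes basis: "orthonormal_basis e"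
begin

lemma ortho: "cinner (e i) (e j) = (if i = j then 1 else 0)"
  using basis by (simp add: orthonormal_basis_def)

text \<open>Most identities for projections and shifts below are checked coordinate by coordinate
  with this rule.\<close>

lemma basis_eqI:
  assumes "\<And>j. cinner x (e j) = cinner y (e j)" shows "x = y"
proof -
  have "x - y \<in> orth_compl (range e)"
    using assms by (auto simp: orth_compl_def cinner_diff_left)
  then show ?thesis using basis by (simp add: orthonormal_basis_iff)
qed

lemma norm_basis_sum:
  "finite I \<Longrightarrow> (norm (\<Sum>m\<in>I. scaleC (c m) (e (m + k))))\<^sup>2 = (\<Sum>m\<in>I. (cmod (c m))\<^sup>2)"
proof -
  have "norm (e m) = 1" for m using ortho[of m m] by (simp add: norm_eq_sqrt_cinner)
  then show "finite I \<Longrightarrow> ?thesis"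
    by (subst norm_sum_sq_orth) (auto simp: cinner_simps ortho)
qed

lemma proj_coeff: "cinner (proj_op e j x) (e m) = (if m < j then cinner x (e m) else 0)"
  unfolding proj_op_def cinner_sum_left cinner_scaleC_left ortho
  by (simp add: if_distrib[of "\<lambda>z. _ * z"] cong: if_cong)

lemma norm_proj_sq: "(norm (proj_op e j x))\<^sup>2 = (\<Sum>m<j. (cmod (cinner x (e m)))\<^sup>2)"
  using norm_basis_sum[of "{..<j}" "\<lambda>m. cinner x (e m)" 0] by (simp add: proj_op_def)

lemma proj_proj: "proj_op e i (proj_op e j x) = proj_op e (min i j) x"
  by (rule basis_eqI) (simp add: proj_coeff)

lemma proj_self_adjoint: "cinner (proj_op e j x) y = cinner x (proj_op e j y)"
  unfolding proj_op_def cinner_sum_left cinner_sum_right cinner_scaleC_left cinner_scaleC_right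
  by (simp flip: cinner_commute) (simp add: mult.commute)

lemma proj_compl_zero: "proj_op e j (x - proj_op e j x) = 0"
  by (rule basis_eqI) (simp add: proj_coeff cinner_diff_left)

lemma norm_proj_pythagoras:
  "(norm x)\<^sup>2 = (norm (proj_op e j x))\<^sup>2 + (norm (x - proj_op e j x))\<^sup>2"
proof -
  have "cinner (proj_op e j x) (x - proj_op e j x) = 0"
    unfolding proj_self_adjoint proj_compl_zero by simp
  from norm_add_sq_orth[OF this] show ?thesis by simp
qed

lemma norm_proj_le: "norm (proj_op e j x) \<le> norm x"
  by (rule power2_le_imp_le) (simp_all add: norm_proj_pythagoras[of x j])

lemma bop_proj: "bounded_clinear_op (proj_op e j)"
  unfolding bounded_clinear_op_def
proof (intro conjI allI)
  show "proj_op e j (x + y) = proj_op e j x + proj_op e j y" for x y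
    by (rule basis_eqI) (simp add: proj_coeff cinner_simps)
  show "proj_op e j (scaleC c x) = scaleC c (proj_op e j x)" for c x
    by (rule basis_eqI) (simp add: proj_coeff cinner_simps)
  show "\<exists>K. \<forall>x. norm (proj_op e j x) \<le> K * norm x"
    using norm_proj_le by (intro exI[of _ 1]) simp
qed

lemma adj_proj: "adj (proj_op e j) = proj_op e j"
  by (rule adj_eqI) (simp add: is_adjoint_def proj_self_adjoint)

lemma proj_basis: "proj_op e j (e m) = (if m < j then e m else 0)"
  by (rule basis_eqI) (auto simp: proj_coeff ortho)

lemma proj_id_iff: "proj_op e j x = x \<longleftrightarrow> (\<forall>m\<ge>j. cinner x (e m) = 0)"
proof
  assume "proj_op e j x = x"
  then show "\<forall>m\<ge>j. cinner x (e m) = 0" by (metis proj_coeff not_le)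
next
  assume "\<forall>m\<ge>j. cinner x (e m) = 0"
  then show "proj_op e j x = x" by (intro basis_eqI) (simp add: proj_coeff)
qed

lemma proj_zero_iff: "proj_op e j x = 0 \<longleftrightarrow> (\<forall>m<j. cinner x (e m) = 0)"
proof
  assume "proj_op e j x = 0"
  then show "\<forall>m<j. cinner x (e m) = 0" by (metis proj_coeff cinner_zero_left)
next
  assume "\<forall>m<j. cinner x (e m) = 0"
  then show "proj_op e j x = 0" by (intro basis_eqI) (simp add: proj_coeff)
qed

lemma proj_orth: "proj_op e j x = x \<Longrightarrow> proj_op e j y = 0 \<Longrightarrow> cinner x y = 0"
  by (metis proj_self_adjoint cinner_zero_right)

lemma range_proj: "range (proj_op e j) = cvs.span (e ` {..<j})"
proof
  show "range (proj_op e j) \<subseteq> cvs.span (e ` {..<j})"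
    unfolding proj_op_def by (auto intro!: cvs.span_sum cvs.span_scale intro: cvs.span_base)
  have "e ` {..<j} \<subseteq> range (proj_op e j)"
  proof
    fix x assume "x \<in> e ` {..<j}"
    then have "x = proj_op e j x" by (auto simp: proj_basis)
    then show "x \<in> range (proj_op e j)" by blast
  qed
  then show "cvs.span (e ` {..<j}) \<subseteq> range (proj_op e j)"
    by (rule cvs.span_minimal)
      (rule module_hom.subspace_image[OF bounded_clinear_op_module_hom[OF bop_proj] cvs.subspace_UNIV])
qed

lemma range_proj_iff: "x \<in> range (proj_op e j) \<longleftrightarrow> proj_op e j x = x"
  using proj_proj[of j j] by (metis min.idem rangeE rangeI)

lemma has_cdim_range_proj: "has_cdim (range (proj_op e j)) j"
  unfolding range_proj using ortho
  by (intro orthonormal_has_cdim) (simp add: orthonormal_on_def)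

lemma orth_compl_range_proj: "orth_compl (range (proj_op e j)) = {x. proj_op e j x = 0}"
  unfolding range_proj orth_compl_span by (auto simp: orth_compl_def proj_zero_iff)

lemma orth_compl_kernel_proj: "orth_compl {x. proj_op e j x = 0} = range (proj_op e j)"
proof (intro equalityI subsetI)
  fix y assume y: "y \<in> orth_compl {x. proj_op e j x = 0}"
  have "proj_op e j (e m) = 0" if "j \<le> m" for m using that by (simp add: proj_basis)
  then have "\<forall>m\<ge>j. cinner y (e m) = 0" using y by (auto simp: orth_compl_def)
  then show "y \<in> range (proj_op e j)" unfolding range_proj_iff proj_id_iff .
next
  fix y assume "y \<in> range (proj_op e j)"
  then show "y \<in> orth_compl {x. proj_op e j x = 0}"
    unfolding range_proj_iff using proj_orth by (auto simp: orth_compl_def)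
qed

lemma bessel: "summable (\<lambda>m. (cmod (cinner x (e m)))\<^sup>2)"
proof (rule bounded_imp_summable)
  show "(\<Sum>m\<le>j. (cmod (cinner x (e m)))\<^sup>2) \<le> (norm x)\<^sup>2" for j
    using power_mono[OF norm_proj_le[of "Suc j" x], of 2]
    unfolding norm_proj_sq lessThan_Suc_atMost by simp
qed simp

text \<open>The offset \<open>k\<close> lets the same result serve the basis expansion (k = 0) and
  the series defining \<open>shift_op\<close>.\<close>

lemma summable_basis:
  assumes "summable (\<lambda>m. (cmod (c m))\<^sup>2)"
  shows "summable (\<lambda>m. scaleC (c m) (e (m + k)))"
  unfolding summable_Cauchy
proof (intro allI impI)
  fix r :: real assume "0 < r"
  then have "0 < r\<^sup>2" by simp
  then obtain N where N: "\<And>m n. N \<le> m \<Longrightarrow> norm (\<Sum>i\<in>{m..<n}. (cmod (c i))\<^sup>2) < r\<^sup>2"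
    using assms unfolding summable_Cauchy by blast
  have "norm (\<Sum>i\<in>{m..<n}. scaleC (c i) (e (i + k))) < r" if "N \<le> m" for m n
  proof (rule power_less_imp_less_base[of _ 2])
    show "(norm (\<Sum>i\<in>{m..<n}. scaleC (c i) (e (i + k))))\<^sup>2 < r\<^sup>2"
      using N[OF that, of n] by (simp add: norm_basis_sum sum_nonneg)
  qed (use \<open>0 < r\<close> in simp)
  then show "\<exists>N. \<forall>m\<ge>N. \<forall>n. norm (\<Sum>i\<in>{m..<n}. scaleC (c i) (e (i + k))) < r" by blast
qed

lemma suminf_basis_coeff:
  assumes "summable (\<lambda>m. (cmod (c m))\<^sup>2)"
  shows "cinner (\<Sum>m. scaleC (c m) (e (m + k))) (e j) = (if k \<le> j then c (j - k) else 0)"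
proof -
  have "cinner (\<Sum>m. scaleC (c m) (e (m + k))) (e j) = (\<Sum>m. cinner (scaleC (c m) (e (m + k))) (e j))"
    by (rule bounded_linear.suminf[OF bounded_bilinear.bounded_linear_left[OF bounded_bilinear_cinner]
          summable_basis[OF assms]])
  also have "\<dots> = (\<Sum>m\<in>(if k \<le> j then {j - k} else {}). cinner (scaleC (c m) (e (m + k))) (e j))"
    by (intro suminf_finite) (auto simp: cinner_simps ortho split: if_splits)
  also have "\<dots> = (if k \<le> j then c (j - k) else 0)"
    by (simp add: cinner_simps ortho)
  finally show ?thesis .
qed

lemma basis_expansion: "(\<lambda>m. scaleC (cinner x (e m)) (e m)) sums x"
proof -
  have "(\<Sum>m. scaleC (cinner x (e m)) (e m)) = x"
    using suminf_basis_coeff[OF bessel[of x], of 0] by (intro basis_eqI) simp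
  then show ?thesis using summable_basis[OF bessel[of x], of 0] by (simp add: sums_iff)
qed

lemma parseval: "(\<lambda>m. (cmod (cinner x (e m)))\<^sup>2) sums (norm x)\<^sup>2"
proof -
  have "(\<lambda>j. (norm (\<Sum>m<j. scaleC (cinner x (e m)) (e m)))\<^sup>2) \<longlonglongrightarrow> (norm x)\<^sup>2"
    using basis_expansion[of x] unfolding sums_def by (intro tendsto_intros)
  then show ?thesis
    unfolding sums_def norm_proj_sq[symmetric] by (simp add: proj_op_def)
qed

text \<open>This is the Parseval identity for \<open>x - proj_op e j x\<close>, whose first
  \<open>j\<close> coefficients vanish.\<close>

lemma parseval_tail: "(\<lambda>m. (cmod (cinner x (e (m + j))))\<^sup>2) sums (norm (x - proj_op e j x))\<^sup>2"
proof -
  let ?f = "\<lambda>m. (cmod (cinner (x - proj_op e j x) (e m)))\<^sup>2"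
  have "(\<lambda>m. ?f (m + j)) sums (norm (x - proj_op e j x))\<^sup>2"
    by (subst sums_zero_iff_shift) (simp add: cinner_diff_left proj_coeff, rule parseval)
  then show ?thesis by (simp add: cinner_diff_left proj_coeff)
qed

lemma shift_coeff: "cinner (shift_op e k x) (e j) = (if k \<le> j then cinner x (e (j - k)) else 0)"
  unfolding shift_op_def by (rule suminf_basis_coeff[OF bessel])

lemma shift_basis: "shift_op e k (e m) = e (m + k)"
  by (rule basis_eqI) (auto simp: shift_coeff ortho)

text \<open>The first \<open>k\<close> coefficients of the shifted vector vanish and the others are
  those of \<open>x\<close>, so both norms are the sum of the same series.\<close>

lemma norm_shift: "norm (shift_op e k x) = norm x"
proof -
  have "proj_op e k (shift_op e k x) = 0" by (simp add: proj_zero_iff shift_coeff)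
  then have "(\<lambda>m. (cmod (cinner x (e m)))\<^sup>2) sums (norm (shift_op e k x))\<^sup>2"
    using parseval_tail[of "shift_op e k x" k] by (simp add: shift_coeff)
  from sums_unique2[OF this parseval] show ?thesis by (simp add: power2_eq_iff_nonneg)
qed

lemma bop_shift: "bounded_clinear_op (shift_op e k)"
  unfolding bounded_clinear_op_def
proof (intro conjI allI)
  show "shift_op e k (x + y) = shift_op e k x + shift_op e k y" for x y
    by (rule basis_eqI) (simp add: shift_coeff cinner_simps)
  show "shift_op e k (scaleC c x) = scaleC c (shift_op e k x)" for c x
    by (rule basis_eqI) (simp add: shift_coeff cinner_simps)
  show "\<exists>K. \<forall>x. norm (shift_op e k x) \<le> K * norm x"
    using norm_shift by (intro exI[of _ 1]) simp
qed

lemma proj_shift: "proj_op e j x = 0 \<Longrightarrow> proj_op e (j + k) (shift_op e k x) = 0"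
  by (simp add: proj_zero_iff shift_coeff)

lemma proj_shift_id: "proj_op e j x = x \<Longrightarrow> proj_op e (j + k) (shift_op e k x) = shift_op e k x"
  by (simp add: proj_id_iff shift_coeff)

lemma proj_zero_mono: "proj_op e j x = 0 \<Longrightarrow> i \<le> j \<Longrightarrow> proj_op e i x = 0"
  by (simp add: proj_zero_iff)

lemma proj_id_mono: "proj_op e i x = x \<Longrightarrow> i \<le> j \<Longrightarrow> proj_op e j x = x"
  by (simp add: proj_id_iff)

end

subsection \<open>Operators acting as a shift on a tail of the basis\<close>

text \<open>Used with a common tail contribution \<open>c\<close>: it cancels, so comparing a power
  of \<open>T\<close> with the identity amounts to comparing \<open>Fr\<close> with a
  projection.\<close>

lemma pythagoras_compare:
  fixes a b c p x :: real
  assumes "0 \<le> a" "0 \<le> b" "0 \<le> p" "0 \<le> x" "a\<^sup>2 = b\<^sup>2 + c" "x\<^sup>2 = p\<^sup>2 + c"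
  shows "a \<le> x \<longleftrightarrow> b \<le> p" "a = x \<longleftrightarrow> b = p"
proof -
  have "a\<^sup>2 \<le> x\<^sup>2 \<longleftrightarrow> b\<^sup>2 \<le> p\<^sup>2" "a\<^sup>2 = x\<^sup>2 \<longleftrightarrow> b\<^sup>2 = p\<^sup>2"
    unfolding assms(5,6) by simp_all
  then show "a \<le> x \<longleftrightarrow> b \<le> p" "a = x \<longleftrightarrow> b = p"
    unfolding power_mono_iff[OF assms(1,4) zero_less_numeral]
      power_mono_iff[OF assms(2,3) zero_less_numeral]
      power2_eq_iff_nonneg[OF assms(1,4)] power2_eq_iff_nonneg[OF assms(2,3)] .
qed

text \<open>Identifies the operator F + S P_n of the theorem with T P_n. Only the behaviour on the
  tail enters, so that the converse direction can use it before the range condition has been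
  translated.\<close>

lemma (in onb) compression_eq:
  assumes "\<And>z. proj_op e n z = 0 \<Longrightarrow> T z = shift_op e k z" "bounded_clinear_op T"
  shows "T x - shift_op e k x + shift_op e k (proj_op e n x) = T (proj_op e n x)"
proof -
  have "T (x - proj_op e n x) = shift_op e k (x - proj_op e n x)"
    using assms(1) proj_compl_zero by blast
  then show ?thesis
    by (simp add: bop_simps[OF assms(2)] bop_simps[OF bop_shift] algebra_simps)
qed

text \<open>\<open>tail\<close> and \<open>corner\<close> restate condition (2) for
  \<open>T\<close>: it is the shift beyond the first \<open>n\<close> basis vectors and maps their
  span into that of the first n + k.\<close>

locale shift_tail = onb e for e :: "nat \<Rightarrow> 'a::chilbert_space" +
  fixes T :: "'a \<Rightarrow> 'a" and n k :: nat
  assumes bop: "bounded_clinear_op T"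
    and tail: "\<And>z. proj_op e n z = 0 \<Longrightarrow> T z = shift_op e k z"
    and corner: "\<And>x. proj_op e (n + k) (T (proj_op e n x)) = T (proj_op e n x)"
begin

abbreviation "F1 \<equiv> \<lambda>x. T (proj_op e n x)"
abbreviation "Fr \<equiv> F_iter e k n F1"

lemma pow_tail:
  "proj_op e n z = 0 \<Longrightarrow> norm ((T ^^ r) z) = norm z \<and> proj_op e (n + k * r) ((T ^^ r) z) = 0"
proof (induction r)
  case (Suc r)
  then have IH: "norm ((T ^^ r) z) = norm z" "proj_op e (n + k * r) ((T ^^ r) z) = 0" by auto
  then have "proj_op e n ((T ^^ r) z) = 0" using proj_zero_mono by simp
  then have "(T ^^ Suc r) z = shift_op e k ((T ^^ r) z)" by (simp add: tail)
  then show ?case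
    using IH proj_shift[OF IH(2), of k] by (simp add: norm_shift ac_simps)
qed simp

lemma pow_basis: "n \<le> m \<Longrightarrow> (T ^^ r) (e m) = e (m + k * r)"
proof (induction r)
  case (Suc r)
  then have "proj_op e n (e (m + k * r)) = 0" by (simp add: proj_basis)
  then show ?case using Suc by (simp add: tail shift_basis ac_simps)
qed simp

text \<open>A vector supported on the first n + kr coordinates splits into its first
  \<open>n\<close> coordinates, governed by \<open>corner\<close>, and a rest that is shifted by
  \<open>k\<close>.\<close>

lemma pow_corner: "proj_op e (n + k * r) ((T ^^ r) (proj_op e n x)) = (T ^^ r) (proj_op e n x)"
proof (induction r)
  case 0
  show ?case by (simp add: proj_proj)
next
  case (Suc r)
  define w where "w = (T ^^ r) (proj_op e n x)"
  have w: "proj_op e (n + k * r) w = w" using Suc by (simp add: w_def)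
  have "proj_op e n w = proj_op e (n + k * r) (proj_op e n w)" by (simp add: proj_proj min_def)
  then have "proj_op e (n + k * r) (w - proj_op e n w) = w - proj_op e n w"
    using w by (simp add: bop_simps[OF bop_proj])
  then have 1: "proj_op e (n + k * r + k) (shift_op e k (w - proj_op e n w)) = shift_op e k (w - proj_op e n w)"
    by (rule proj_shift_id)
  have 2: "proj_op e (n + k * r + k) (T (proj_op e n w)) = T (proj_op e n w)"
    by (rule proj_id_mono[OF corner]) simp
  have "T w = T (proj_op e n w) + shift_op e k (w - proj_op e n w)"
    using tail[OF proj_compl_zero, of w] by (simp add: bop_simps[OF bop] diff_eq_eq add.commute)
  then have "proj_op e (n + k * r + k) (T w) = T w"
    using 1 2 by (simp add: bop_simps(1)[OF bop_proj])
  then show ?case by (simp add: w_def ac_simps)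
qed

text \<open>The images of P_n x and of the tail are supported before and after coordinate n + kr,
  hence are orthogonal, and on the tail the power is isometric.\<close>

lemma norm_pow: "(norm ((T ^^ r) x))\<^sup>2 = (norm ((T ^^ r) (proj_op e n x)))\<^sup>2 + (norm (x - proj_op e n x))\<^sup>2"
proof -
  let ?z = "x - proj_op e n x"
  have z: "norm ((T ^^ r) ?z) = norm ?z" "proj_op e (n + k * r) ((T ^^ r) ?z) = 0"
    using pow_tail[OF proj_compl_zero] by auto
  have "cinner ((T ^^ r) (proj_op e n x)) ((T ^^ r) ?z) = 0"
    using pow_corner z(2) by (rule proj_orth)
  from norm_add_sq_orth[OF this] show ?thesis
    unfolding z(1) by (simp flip: bop_simps[OF bop_funpow[OF bop]])
qed

text \<open>Since the \<open>r\<close>-th power of \<open>T\<close> sends e_m to e_(m + kr) for m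
  \<ge> n, the coefficients of \<open>?w\<close> from index \<open>n\<close> on are those of
  \<open>y\<close> from index n + kr on.\<close>

lemma norm_adj_pow:
  "(norm ((adj T ^^ r) y))\<^sup>2
    = (norm (proj_op e n ((adj T ^^ r) y)))\<^sup>2 + (norm (y - proj_op e (n + k * r) y))\<^sup>2"
proof -
  let ?w = "(adj T ^^ r) y"
  have "cinner ?w (e (m + n)) = cinner y (e (m + (n + k * r)))" for m
    unfolding adj_funpow[OF bop, symmetric] cinner_adj_left[OF bop_funpow[OF bop]]
    by (simp add: pow_basis add.assoc)
  then have "(norm (?w - proj_op e n ?w))\<^sup>2 = (norm (y - proj_op e (n + k * r) y))\<^sup>2"
    using sums_unique2[OF parseval_tail[of ?w n]] parseval_tail[of y "n + k * r"] by simp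
  then show ?thesis using norm_proj_pythagoras[of ?w n] by simp
qed

text \<open>The defining sum is what results from expanding T^r P_n when \<open>T\<close> is split
  at each step into T P_n and the shift on the tail. The exponent is a successor because
  \<open>Fr 0\<close> is the identity, not P_n.\<close>

lemma F_iter_eq: "Fr (Suc r) x = (T ^^ Suc r) (proj_op e n x)"
proof (induction r)
  case 0
  show ?case by (simp add: F_iter_def)
next
  case (Suc r)
  let ?S = "shift_op e k"
  define G where "G = (\<lambda>j. (F1 ^^ j) x - proj_op e n ((F1 ^^ j) x))"
  have G0: "proj_op e n (G j) = 0" for j unfolding G_def by (rule proj_compl_zero)
  have SG: "proj_op e n ((?S ^^ i) (G j)) = 0" for i j
  proof (induction i)
    case (Suc i)
    then show ?case using proj_zero_mono[OF proj_shift[of n _ k]] by simp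
  qed (simp add: G0)
  have F: "Fr r x = (F1 ^^ r) x + (\<Sum>j\<in>{1..<r}. (?S ^^ j) (G (r - j)))" for r
    by (simp add: F_iter_def G_def)
  have "T ((F1 ^^ Suc r) x) = F1 ((F1 ^^ Suc r) x) + T (G (Suc r))"
    unfolding G_def by (simp only: bop_simps[OF bop]) simp
  then have T1: "T ((F1 ^^ Suc r) x) = (F1 ^^ Suc (Suc r)) x + (?S ^^ 1) (G (Suc r))"
    by (simp add: tail[OF G0])
  \<comment> \<open>The term j = 1 comes from \<open>T1\<close>; the remaining terms, reindexed by
    one, are the images under \<open>T\<close> of the terms of the previous sum.\<close>
  have "(\<Sum>j\<in>{1..<Suc (Suc r)}. (?S ^^ j) (G (Suc (Suc r) - j)))
      = (?S ^^ 1) (G (Suc r)) + (\<Sum>j\<in>{Suc 1..<Suc (Suc r)}. (?S ^^ j) (G (Suc (Suc r) - j)))"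
    by (subst sum.atLeast_Suc_lessThan) simp_all
  also have "(\<Sum>j\<in>{Suc 1..<Suc (Suc r)}. (?S ^^ j) (G (Suc (Suc r) - j)))
      = (\<Sum>j\<in>{1..<Suc r}. T ((?S ^^ j) (G (Suc r - j))))"
    unfolding sum.shift_bounds_Suc_ivl by (simp add: tail[OF SG])
  finally have "Fr (Suc (Suc r)) x = T (Fr (Suc r) x)"
    unfolding F[of "Suc (Suc r)"] F[of "Suc r"] bop_simps(1,6)[OF bop] T1
    by (simp only: add.assoc)
  then show ?case using Suc by simp
qed

lemma adj_F1: "adj F1 = (\<lambda>y. proj_op e n (adj T y))"
  using adj_comp[OF bop bop_proj] by (simp add: adj_proj)

lemma adj_F_iter: "adj (Fr (Suc r)) y = proj_op e n ((adj T ^^ Suc r) y)"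
proof -
  have "Fr (Suc r) = (\<lambda>x. (T ^^ Suc r) (proj_op e n x))"
    using F_iter_eq by (rule ext)
  then show ?thesis
    using adj_comp[OF bop_funpow[OF bop] bop_proj, of "Suc r" n]
    by (simp only: adj_proj adj_funpow[OF bop])
qed

text \<open>In \<open>norm_pow\<close> and \<open>norm_adj_pow\<close> the extra term equals the one
  in the Pythagorean splitting of \<open>x\<close> at \<open>n\<close> and at n + kr
  respectively.\<close>

lemma F_iter_compare:
  assumes "1 \<le> r"
  shows "norm (Fr r x) \<le> norm (proj_op e n x) \<longleftrightarrow> norm ((T ^^ r) x) \<le> norm x"
    and "norm (Fr r x) = norm (proj_op e n x) \<longleftrightarrow> norm ((T ^^ r) x) = norm x"
    and "norm (adj (Fr r) x) \<le> norm (proj_op e (n + k * r) x) \<longleftrightarrow> norm ((adj T ^^ r) x) \<le> norm x"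
    and "norm (adj (Fr r) x) = norm (proj_op e (n + k * r) x) \<longleftrightarrow> norm ((adj T ^^ r) x) = norm x"
proof -
  obtain s where r: "r = Suc s" using assms by (cases r) auto
  note 1 = pythagoras_compare[OF _ _ _ _ norm_pow[of r x] norm_proj_pythagoras[of x n]]
  note 2 = pythagoras_compare[OF _ _ _ _ norm_adj_pow[of r x] norm_proj_pythagoras[of x "n + k * r"]]
  have F: "Fr r x = (T ^^ r) (proj_op e n x)" "adj (Fr r) x = proj_op e n ((adj T ^^ r) x)"
    unfolding r by (rule F_iter_eq, rule adj_F_iter)
  show "norm (Fr r x) \<le> norm (proj_op e n x) \<longleftrightarrow> norm ((T ^^ r) x) \<le> norm x"
    and "norm (Fr r x) = norm (proj_op e n x) \<longleftrightarrow> norm ((T ^^ r) x) = norm x"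
    and "norm (adj (Fr r) x) \<le> norm (proj_op e (n + k * r) x) \<longleftrightarrow> norm ((adj T ^^ r) x) \<le> norm x"
    and "norm (adj (Fr r) x) = norm (proj_op e (n + k * r) x) \<longleftrightarrow> norm ((adj T ^^ r) x) = norm x"
    unfolding F using 1 2 norm_ge_zero by (blast+)
qed

lemma completely_non_unitary_iff_F_iter:
  assumes "contraction T"
  shows "completely_non_unitary T \<longleftrightarrow>
    (\<forall>x. (\<forall>r\<ge>1. norm (Fr r x) = norm (proj_op e n x)
      \<and> norm (adj (Fr r) x) = norm (proj_op e (n + k * r) x)) \<longrightarrow> x = 0)"
  unfolding completely_non_unitary_iff[OF assms] by (simp add: F_iter_compare cong: conj_cong)

lemma F_iter_bounds:
  assumes "contraction T" "1 \<le> r"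
  shows "norm (Fr r x) \<le> norm (proj_op e n x)" "norm (adj (Fr r) x) \<le> norm (proj_op e (n + k * r) x)"
  using contraction_funpow[OF assms(1), of r] contraction_funpow[OF contraction_adj[OF assms(1)], of r]
  unfolding F_iter_compare(1,3)[OF assms(2)] contraction_def by blast+

lemma contraction_if_F_iter_bound:
  assumes "\<And>x. norm (Fr 1 x) \<le> norm (proj_op e n x)"
  shows "contraction T"
  using assms F_iter_compare(1)[of 1] bop by (simp add: contraction_def)

text \<open>I - T*T vanishes on the tail, so only its compression to the first \<open>n\<close>
  coordinates remains, and there T*T is F1*F1.\<close>

lemma defect_sq_eq:
  assumes T: "contraction T"
  shows "proj_op e n x - adj F1 (F1 x) = x - adj T (T x)"
proof -
  let ?P = "proj_op e n"
  have fixed: "adj T (T z) = z" if "?P z = 0" for z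
    using contraction_norm_eq_iff[OF T, of z] pow_tail[OF that, of 1] by simp
  have "adj T (T (x - ?P x)) = x - ?P x"
    by (rule fixed[OF proj_compl_zero])
  then have x: "adj T (T x) = adj T (F1 x) + (x - ?P x)"
    by (simp add: bop_simps[OF bop] bop_simps[OF bop_adj[OF bop]] algebra_simps)
  let ?w = "adj T (F1 x)"
  \<comment> \<open>The tail component of T*T P_n x is zero: T*T moves to the tail vector in the
    second slot, fixes it, and leaves it orthogonal to P_n x.\<close>
  have "cinner ?w (?w - ?P ?w) = cinner (?P x) (adj T (T (?w - ?P ?w)))"
    by (simp only: cinner_adj_left[OF bop] cinner_adj[OF bop])
  also have "\<dots> = 0"
    unfolding fixed[OF proj_compl_zero] by (rule proj_orth[of n]) (simp_all add: proj_proj proj_compl_zero)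
  finally have "cinner ?w (?w - ?P ?w) = 0" .
  moreover have "cinner (?P ?w) (?w - ?P ?w) = 0"
    by (rule proj_orth[of n]) (simp_all add: proj_proj proj_compl_zero)
  ultimately have "cinner (?w - ?P ?w) (?w - ?P ?w) = 0" by (simp only: cinner_diff_left) simp
  then have "?P ?w = ?w" by (simp add: cinner_eq_zero_iff)
  then show ?thesis unfolding adj_F1 x by simp
qed

end

section \<open>Kernel and range of I - T*T, and the conditions on rank and domination\<close>

lemma cinner_defect_sq:
  fixes T :: "'a::chilbert_space \<Rightarrow> 'a"
  assumes "bounded_clinear_op T"
  shows "cinner (x - adj T (T x)) y = cinner x (y - adj T (T y))"
  by (simp only: cinner_diff_left cinner_diff_right cinner_adj_left[OF assms] cinner_adj[OF assms, symmetric])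

lemma bop_defect_sq:
  fixes T :: "'a::chilbert_space \<Rightarrow> 'a"
  shows "bounded_clinear_op T \<Longrightarrow> bounded_clinear_op (\<lambda>x. x - adj T (T x))"
  by (rule bop_diff[OF bop_id bop_comp[OF bop_adj]])

lemma orth_compl_range_defect_sq:
  fixes T :: "'a::chilbert_space \<Rightarrow> 'a"
  assumes "bounded_clinear_op T"
  shows "orth_compl (range (\<lambda>x. x - adj T (T x))) = {x. adj T (T x) = x}"
proof (intro equalityI subsetI)
  fix x assume "x \<in> orth_compl (range (\<lambda>x. x - adj T (T x)))"
  then have "cinner (x - adj T (T x)) y = cinner 0 y" for y
    unfolding cinner_defect_sq[OF assms] by (simp add: orth_compl_def)
  then show "x \<in> {x. adj T (T x) = x}" using cinner_eqI[of "x - adj T (T x)" 0] by simp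
next
  fix x assume "x \<in> {x. adj T (T x) = x}"
  then show "x \<in> orth_compl (range (\<lambda>x. x - adj T (T x)))"
    by (auto simp: orth_compl_def cinner_defect_sq[OF assms, symmetric])
qed

text \<open>I - T*T maps the defect space into itself and is injective there, since its kernel is
  the orthogonal complement; finite dimension makes it onto.\<close>

lemma range_defect_sq:
  fixes T :: "'a::chilbert_space \<Rightarrow> 'a"
  assumes T: "contraction T" and dim: "has_cdim (defect_space T) m"
  shows "range (\<lambda>x. x - adj T (T x)) = defect_space T"
proof -
  let ?A = "\<lambda>x. x - adj T (T x)"
  have A: "bounded_clinear_op ?A" by (rule bop_defect_sq[OF contraction_bop[OF T]])
  have sub: "range ?A \<subseteq> defect_space T"
    unfolding defect_op_properties(2)[OF T, symmetric] defect_space_def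
    using closure_subset[of "range (defect_op T)"] by blast
  have V: "cvs.subspace (defect_space T)"
    unfolding defect_space_eq[OF T] by (rule subspace_orth_compl)
  have "inj_on ?A (defect_space T)"
  proof (rule inj_onI)
    fix x y assume xy: "x \<in> defect_space T" "y \<in> defect_space T" and eq: "?A x = ?A y"
    have "?A (x - y) = 0" using eq bop_simps(2)[OF A, of x y] by simp
    then have "adj T (T (x - y)) = x - y" by simp
    moreover have "x - y \<in> defect_space T" using V xy by (rule cvs.subspace_diff)
    ultimately have "cinner (x - y) (x - y) = 0"
      unfolding defect_space_eq[OF T] by (simp add: orth_compl_def)
    then show "x = y" by (simp add: cinner_eq_zero_iff)
  qed
  then have "has_cdim (?A ` defect_space T) m"
    using has_cdim_image[OF bounded_clinear_op_module_hom[OF A]] dim by blast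
  then have "?A ` defect_space T = defect_space T"
    using has_cdim_subset_eq[OF _ dim] sub by blast
  then show ?thesis using sub by blast
qed

context shift_tail
begin

text \<open>The range of I - T*T lies in the \<open>n\<close>-dimensional range of P_n and has
  dimension \<open>n\<close>, so the two agree; complements then give the kernel and both defect
  spaces.\<close>

lemma defect_space_of_rank:
  assumes T: "contraction T" and rank: "rank_eq (\<lambda>x. proj_op e n x - adj F1 (F1 x)) n"
  shows "{x. adj T (T x) = x} = {x. proj_op e n x = 0}"
    and "defect_space T = range (proj_op e n)"
    and "defect_space (adj T) = range (proj_op e (n + k))"
proof -
  let ?P = "proj_op e n"
  have "range (\<lambda>x. x - adj T (T x)) \<subseteq> range ?P"
  proof -
    have "?P x - adj F1 (F1 x) = ?P (x - adj T (F1 x))" for x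
      by (simp add: adj_F1 bop_simps[OF bop_proj])
    then show ?thesis unfolding defect_sq_eq[OF T] by auto
  qed
  moreover have "has_cdim (range (\<lambda>x. x - adj T (T x))) n"
    using rank unfolding rank_eq_def defect_sq_eq[OF T] .
  ultimately have "range (\<lambda>x. x - adj T (T x)) = range ?P"
    using has_cdim_subset_eq has_cdim_range_proj by blast
  then show ker: "{x. adj T (T x) = x} = {x. ?P x = 0}"
    using orth_compl_range_defect_sq[OF bop] orth_compl_range_proj[of n] by simp
  then show "defect_space T = range ?P"
    unfolding defect_space_eq[OF T] by (simp add: orth_compl_kernel_proj)
  \<comment> \<open>If \<open>x\<close> is fixed, then \<open>adj T x\<close> is fixed by T*T, hence
    is a tail vector, and \<open>x\<close> is its shift. Conversely \<open>norm_adj_pow\<close> for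
    r = 1 shows that \<open>adj T\<close> does not shrink \<open>x\<close>.\<close>
  have "{x. T (adj T x) = x} = {x. proj_op e (n + k) x = 0}"
  proof (intro equalityI subsetI)
    fix x assume "x \<in> {x. T (adj T x) = x}"
    then have x: "T (adj T x) = x" by simp
    then have "adj T x \<in> {x. adj T (T x) = x}" by simp
    then have z: "?P (adj T x) = 0" unfolding ker by simp
    then have "shift_op e k (adj T x) = x" using tail x by simp
    then show "x \<in> {x. proj_op e (n + k) x = 0}" using proj_shift[OF z, of k] by simp
  next
    fix x assume "x \<in> {x. proj_op e (n + k) x = 0}"
    then have "(norm x)\<^sup>2 \<le> (norm (adj T x))\<^sup>2" using norm_adj_pow[of 1 x] by simp
    then have "norm x \<le> norm (adj T x)" by (rule power2_le_imp_le) simp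
    moreover have "norm (adj T x) \<le> norm x"
      using contraction_adj[OF T] by (simp add: contraction_def)
    ultimately show "x \<in> {x. T (adj T x) = x}"
      using contraction_norm_eq_iff[OF contraction_adj[OF T], of x] by (simp add: adj_adj[OF bop])
  qed
  then show "defect_space (adj T) = range (proj_op e (n + k))"
    unfolding defect_space_eq[OF contraction_adj[OF T]] adj_adj[OF bop]
    by (simp add: orth_compl_kernel_proj)
qed

text \<open>T - S vanishes on the tail, so its range is the image of the span of the first
  \<open>n\<close> basis vectors.\<close>

lemma finite_rank_diff_shift: "finite_rank (\<lambda>x. T x - shift_op e k x)"
proof -
  let ?F = "\<lambda>x. T x - shift_op e k x"
  have F: "bounded_clinear_op ?F" by (rule bop_diff[OF bop bop_shift])
  have "?F x = ?F (proj_op e n x)" for x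
    using tail[OF proj_compl_zero, of x] bop_simps(2)[OF F, of x "proj_op e n x"] by simp
  then have "range ?F = ?F ` range (proj_op e n)" by (metis (no_types, lifting) image_image image_cong)
  also have "\<dots> = cvs.span (?F ` e ` {..<n})"
    unfolding range_proj by (rule module_hom.span_image[OF bounded_clinear_op_module_hom[OF F], symmetric])
  finally show ?thesis unfolding finite_rank_def by (simp add: fin_cdim_span)
qed

text \<open>I - TT* is onto the range of P_(n + k), and this yields an explicit bound of |P_(n + k)
  x|^2 by a multiple of |D x|^2 with \<open>D\<close> the defect operator of
  \<open>adj T\<close>.\<close>

lemma domination:
  assumes T: "contraction T" and defect: "defect_space (adj T) = range (proj_op e (n + k))"
  shows "\<exists>lam\<ge>0. \<forall>x. lam * (norm (adj F1 x))\<^sup>2 - (norm (F1 x))\<^sup>2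
    \<le> lam * (norm (proj_op e (n + k) x))\<^sup>2 - (norm (proj_op e n x))\<^sup>2"
proof -
  note T' = contraction_adj[OF T]
  let ?D = "defect_op (adj T)"
  have "range (\<lambda>x. x - adj (adj T) (adj T x)) = range (proj_op e (n + k))"
    using range_defect_sq[OF T', of "n + k"] defect has_cdim_range_proj by simp
  moreover have "e i \<in> range (proj_op e (n + k))" if "i < n + k" for i
    using that by (simp add: range_proj_iff proj_basis)
  ultimately have "\<exists>y. i < n + k \<longrightarrow> e i = ?D (?D y)" for i
    unfolding defect_op_properties(2)[OF T'] by blast
  then obtain y where y: "\<And>i. i < n + k \<Longrightarrow> e i = ?D (?D (y i))" by metis
  \<comment> \<open>Writing e_i = D^2 y_i, the coefficient of \<open>x\<close> at \<open>i\<close>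
    is the inner product of D x and D y_i; Cauchy-Schwarz and summation over \<open>i\<close> give
    this constant.\<close>
  define lam where "lam = (\<Sum>i<n + k. (norm (?D (y i)))\<^sup>2)"
  have lam: "0 \<le> lam" unfolding lam_def by (intro sum_nonneg) simp
  have "lam * (norm (adj F1 x))\<^sup>2 - (norm (F1 x))\<^sup>2
    \<le> lam * (norm (proj_op e (n + k) x))\<^sup>2 - (norm (proj_op e n x))\<^sup>2" for x
  proof -
    have coeff: "(cmod (cinner x (e i)))\<^sup>2 \<le> (norm (?D x))\<^sup>2 * (norm (?D (y i)))\<^sup>2" if "i < n + k" for i
    proof -
      have "cinner x (e i) = cinner (?D x) (?D (y i))"
        unfolding y[OF that] positive_op_self_adjoint[OF defect_op_properties(1)[OF T'], symmetric] ..
      then show ?thesis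
        using power_mono[OF cauchy_schwarz[of "?D x" "?D (y i)"], of 2] by (simp add: power_mult_distrib)
    qed
    have "(norm (proj_op e n x))\<^sup>2 \<le> (norm (proj_op e (n + k) x))\<^sup>2"
      unfolding norm_proj_sq by (intro sum_mono2) auto
    also have "\<dots> \<le> (\<Sum>i<n + k. (norm (?D x))\<^sup>2 * (norm (?D (y i)))\<^sup>2)"
      unfolding norm_proj_sq by (intro sum_mono coeff) simp
    also have "\<dots> = lam * (norm (?D x))\<^sup>2"
      unfolding lam_def sum_distrib_right by (simp only: mult.commute)
    also have "(norm (?D x))\<^sup>2 = (norm (proj_op e (n + k) x))\<^sup>2 - (norm (adj F1 x))\<^sup>2"
      unfolding norm_defect_op_sq[OF T'] adj_F1
      using norm_adj_pow[of 1 x] norm_proj_pythagoras[of x "n + k"] by simp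
    finally have "(norm (proj_op e n x))\<^sup>2
      \<le> lam * (norm (proj_op e (n + k) x))\<^sup>2 - lam * (norm (adj F1 x))\<^sup>2"
      by (simp only: right_diff_distrib)
    moreover have "0 \<le> (norm (F1 x))\<^sup>2" by simp
    ultimately show ?thesis by linarith
  qed
  then show ?thesis using lam by blast
qed

end

subsection \<open>The basis adapted to a completely non-unitary contraction\<close>

lemma orth_compl_antimono: "M \<subseteq> N \<Longrightarrow> orth_compl N \<subseteq> orth_compl M"
  by (auto simp: orth_compl_def)

lemma orth_compl_defect_space:
  fixes T :: "'a::chilbert_space \<Rightarrow> 'a"
  assumes T: "contraction T"
  shows "orth_compl (defect_space T) = {x. adj T (T x) = x}"
proof -
  have "{x. adj T (T x) = x} = orth_compl (range (\<lambda>x. x - adj T (T x)))"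
    by (rule orth_compl_range_defect_sq[OF contraction_bop[OF T], symmetric])
  then have "cvs.subspace {x. adj T (T x) = x}" "closed {x. adj T (T x) = x}"
    using subspace_orth_compl closed_orth_compl by metis+
  then show ?thesis unfolding defect_space_eq[OF T] by (simp add: orth_compl_orth_compl)
qed

lemma orth_diff_decomposition:
  assumes "cvs.subspace V" "cvs.subspace W" "closed V" "V \<subseteq> (W :: 'a::chilbert_space set)" "d \<in> W"
  obtains p q where "p \<in> V" "q \<in> orth_diff W V" "d = p + q"
proof -
  obtain p where p: "p \<in> V" "d - p \<in> orth_compl V"
    using projection_theorem[OF assms(1,3)] .
  have "d - p \<in> W" using assms p(1) cvs.subspace_diff by blast
  then have "d - p \<in> orth_diff W V" using p(2) by (simp add: orth_diff_def orth_compl_def)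
  then show thesis using that[of p "d - p"] p(1) by simp
qed

text \<open>A Wold decomposition: \<open>T\<close> is isometric on the complement of
  \<open>V\<close>, which it leaves invariant, with wandering subspace \<open>W\<close>; the basis
  consists of a basis of \<open>V\<close> followed by the images of a basis of \<open>W\<close>
  under the powers of \<open>T\<close>.\<close>

lemma adapted_basis:
  fixes T :: "'a::chilbert_space \<Rightarrow> 'a"
  assumes T: "contraction T" and cnu: "completely_non_unitary T"
    and sub: "defect_space T \<subseteq> defect_space (adj T)"
    and dim_n: "has_cdim (defect_space T) n"
    and dim_k: "has_cdim (orth_diff (defect_space (adj T)) (defect_space T)) k"
    and k: "0 < k"
  shows "\<exists>e. shift_tail e T n k \<and> defect_space T = range (proj_op e n)
    \<and> defect_space (adj T) = range (proj_op e (n + k))"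
proof -
  have b: "bounded_clinear_op T" using T by (rule contraction_bop)
  note T' = contraction_adj[OF T]
  define V where "V = defect_space T"
  define V' where "V' = defect_space (adj T)"
  define W where "W = orth_diff V' V"
  have K: "x \<in> orth_compl V \<longleftrightarrow> adj T (T x) = x" for x
    unfolding V_def orth_compl_defect_space[OF T] by simp
  have L: "x \<in> orth_compl V' \<longleftrightarrow> T (adj T x) = x" for x
    unfolding V'_def orth_compl_defect_space[OF T'] adj_adj[OF b] by simp
  have V_eq: "V = orth_compl {x. adj T (T x) = x}" and V'_eq: "V' = orth_compl {x. T (adj T x) = x}"
    unfolding V_def V'_def using defect_space_eq[OF T] defect_space_eq[OF T'] adj_adj[OF b] by simp_all
  have subV: "cvs.subspace V" "closed V" and subV': "cvs.subspace V'"
    unfolding V_eq V'_eq by (simp_all only: subspace_orth_compl closed_orth_compl)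
  have VV': "V \<subseteq> V'" using sub by (simp add: V_def V'_def)
  have LK: "orth_compl V' \<subseteq> orth_compl V" using VV' by (rule orth_compl_antimono)
  have T_KL: "T x \<in> orth_compl V'" if "x \<in> orth_compl V" for x using that K L by simp
  have iso: "cinner (T x) (T y) = cinner x y" if "x \<in> orth_compl V" for x y
    using that by (simp add: K cinner_adj_left[OF b, symmetric])
  obtain u where u: "orthonormal_on {..<n} u" and spanu: "cvs.span (u ` {..<n}) = V"
    using has_cdim_orthonormal[OF dim_n] unfolding V_def by blast
  obtain v where v: "orthonormal_on {..<k} v" and spanv: "cvs.span (v ` {..<k}) = W"
    using has_cdim_orthonormal[OF dim_k] unfolding V_def V'_def W_def by blast
  have uV: "u i \<in> V" if "i < n" for i
    using that cvs.span_superset[of "u ` {..<n}"] spanu by blast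
  have vW: "v i \<in> W" if "i < k" for i
    using that cvs.span_superset[of "v ` {..<k}"] spanv by blast
  have W_iff: "x \<in> W \<longleftrightarrow> x \<in> V' \<and> x \<in> orth_compl V" for x
    by (simp add: W_def orth_diff_def orth_compl_def)
  have powK: "(T ^^ a) x \<in> orth_compl V" if "x \<in> orth_compl V" for a x
    using that T_KL LK by (induction a) auto
  have powL: "(T ^^ Suc a) x \<in> orth_compl V'" if "x \<in> orth_compl V" for a x
    using powK[OF that] T_KL by simp
  have pow_iso: "cinner ((T ^^ a) x) ((T ^^ (a + c)) y) = cinner x ((T ^^ c) y)"
    if "x \<in> orth_compl V" for a c x y
    by (induction a) (simp_all add: iso powK[OF that])
  \<comment> \<open>The smaller power cancels because \<open>T\<close> is isometric off
    \<open>V\<close>; a remaining positive power of \<open>T\<close> lands in the complement of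
    \<open>V'\<close>, whereas \<open>v i\<close> lies in \<open>V'\<close>.\<close>
  have pow_ortho_le: "cinner ((T ^^ a) (v i)) ((T ^^ b) (v j)) = (if a = b \<and> i = j then 1 else 0)"
    if "a \<le> b" "i < k" "j < k" for a b i j
  proof -
    have ij: "v i \<in> orth_compl V" "v j \<in> orth_compl V" "v i \<in> V'" using that vW W_iff by auto
    obtain c where c: "b = a + c" using \<open>a \<le> b\<close> le_Suc_ex by blast
    show ?thesis
    proof (cases c)
      case 0
      then show ?thesis using pow_iso[OF ij(1), of a 0 "v j"] that orthonormal_onD[OF v, of i j] c by simp
    next
      case (Suc d)
      then have "cinner ((T ^^ c) (v j)) (v i) = 0"
        using powL[OF ij(2), of d] ij(3) by (auto simp: orth_compl_def)
      then show ?thesis using pow_iso[OF ij(1), of a c "v j"] c Suc cinner_zero_commute by auto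
    qed
  qed
  have pow_ortho: "cinner ((T ^^ a) (v i)) ((T ^^ b) (v j)) = (if a = b \<and> i = j then 1 else 0)"
    if "i < k" "j < k" for a b i j
  proof (cases "a \<le> b")
    case False
    then show ?thesis
      using pow_ortho_le[of b a j i] that cinner_commute[of "(T ^^ a) (v i)" "(T ^^ b) (v j)"] by simp
  qed (use pow_ortho_le that in simp)
  \<comment> \<open>Quotient and remainder by \<open>k\<close> enumerate the vectors T^a v_j block
    by block, so that \<open>T\<close> advances the index by exactly \<open>k\<close>.\<close>
  define f where "f = (\<lambda>t. (T ^^ (t div k)) (v (t mod k)))"
  define e where "e = (\<lambda>m. if m < n then u m else f (m - n))"
  have f_K: "f t \<in> orth_compl V" for t
    unfolding f_def using powK W_iff vW k by simp
  have f_ortho: "cinner (f s) (f t) = (if s = t then 1 else 0)" for s t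
  proof -
    have "s div k = t div k \<and> s mod k = t mod k \<longleftrightarrow> s = t" by (metis div_mult_mod_eq)
    then show ?thesis unfolding f_def using k by (simp add: pow_ortho)
  qed
  have f_pow: "f (a * k + j) = (T ^^ a) (v j)" if "j < k" for a j
    using that by (simp add: f_def)
  have e_u: "e m = u m" if "m < n" for m using that by (simp add: e_def)
  have e_f: "e (n + t) = f t" for t by (simp add: e_def)
  have "cinner (e i) (e j) = (if i = j then 1 else 0)" for i j
  proof (cases "i < n"; cases "j < n")
    assume "i < n" "j < n"
    then show ?thesis using orthonormal_onD[OF u] by (simp add: e_def)
  next
    assume "i < n" "\<not> j < n"
    then have "cinner (f (j - n)) (u i) = 0" using f_K uV by (auto simp: orth_compl_def)
    then show ?thesis using \<open>i < n\<close> \<open>\<not> j < n\<close> cinner_zero_commute by (auto simp: e_def)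
  next
    assume "\<not> i < n" "j < n"
    then show ?thesis using f_K uV by (auto simp: e_def orth_compl_def)
  next
    assume "\<not> i < n" "\<not> j < n"
    then show ?thesis by (auto simp: e_def f_ortho)
  qed
  then have "orthonormal_on UNIV e" by (simp add: orthonormal_on_def)
  moreover have "orth_compl (range e) = {0}"
  proof (intro equalityI subsetI)
    fix x assume x: "x \<in> orth_compl (range e)"
    \<comment> \<open>\<open>N\<close> is what the proposed basis misses. It is shown invariant
      under \<open>T\<close> and \<open>adj T\<close>, both isometric on it, so complete
      non-unitarity forces \<open>x\<close> to be zero.\<close>
    define N where "N = {x \<in> orth_compl V. \<forall>a. \<forall>j<k. cinner x ((T ^^ a) (v j)) = 0}"
    have N_K: "y \<in> orth_compl V" and N_pow: "j < k \<Longrightarrow> cinner y ((T ^^ a) (v j)) = 0"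
      if "y \<in> N" for y a j using that by (auto simp: N_def)
    have xe: "cinner x (e m) = 0" for m using x by (simp add: orth_compl_def)
    have "cinner x (u i) = 0" if "i < n" for i using xe[of i] e_u[OF that] by simp
    then have "x \<in> orth_compl (u ` {..<n})" by (auto simp: orth_compl_def)
    then have "x \<in> orth_compl V" using orth_compl_span[of "u ` {..<n}"] spanu by simp
    moreover have "cinner x ((T ^^ a) (v j)) = 0" if "j < k" for a j
      using xe[of "n + (a * k + j)"] unfolding e_f f_pow[OF that] .
    ultimately have xN: "x \<in> N" by (simp add: N_def)
    \<comment> \<open>A vector of \<open>N\<close> is orthogonal to \<open>V\<close> and, taking a =
      0, to \<open>W\<close>; together these span \<open>V'\<close>.\<close>
    have N_L: "y \<in> orth_compl V'" if y: "y \<in> N" for y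
    proof -
      have "cinner y (v j) = 0" if "j < k" for j using N_pow[OF y that, of 0] by simp
      then have "y \<in> orth_compl (v ` {..<k})" by (auto simp: orth_compl_def)
      then have yW: "y \<in> orth_compl W" using orth_compl_span[of "v ` {..<k}"] spanv by simp
      have "cinner y d = 0" if d: "d \<in> V'" for d
      proof -
        obtain p q where "p \<in> V" "q \<in> W" "d = p + q"
          using orth_diff_decomposition[OF subV(1) subV' subV(2) VV' d] unfolding W_def by blast
        then show ?thesis using N_K[OF y] yW by (simp add: orth_compl_def cinner_add_right)
      qed
      then show ?thesis by (simp add: orth_compl_def)
    qed
    have N_T: "T y \<in> N" if y: "y \<in> N" for y
    proof -
      have Ty: "T y \<in> orth_compl V'" using T_KL N_K[OF y] by blast
      have "cinner (T y) ((T ^^ a) (v j)) = 0" if "j < k" for a j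
      proof (cases a)
        case 0
        then show ?thesis using Ty vW[OF that] W_iff by (simp add: orth_compl_def)
      next
        case (Suc c)
        then show ?thesis using iso[OF N_K[OF y]] N_pow[OF y that] by simp
      qed
      then show ?thesis using Ty LK by (auto simp: N_def)
    qed
    have N_T': "adj T y \<in> N" if y: "y \<in> N" for y
    proof -
      have TTy: "T (adj T y) = y" using N_L[OF y] L by simp
      have "cinner (adj T y) ((T ^^ a) (v j)) = 0" if "j < k" for a j
        using N_pow[OF y that, of "Suc a"] by (simp add: cinner_adj_left[OF b])
      then show ?thesis using K[of "adj T y"] TTy by (simp add: N_def)
    qed
    have "norm (T y) = norm y" if "y \<in> N" for y
      using N_K[OF that] K contraction_norm_eq_iff[OF T] by simp
    moreover have "norm (adj T y) = norm y" if "y \<in> N" for y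
      using N_L[OF that] L contraction_norm_eq_iff[OF T'] by (simp add: adj_adj[OF b])
    ultimately have "norm ((T ^^ r) x) = norm x \<and> norm ((adj T ^^ r) x) = norm x" for r
      using funpow_norm_fixed[of N T x r] funpow_norm_fixed[of N "adj T" x r] N_T N_T' xN by blast
    then show "x \<in> {0}" using cnu unfolding completely_non_unitary_iff[OF T] by simp
  qed (simp add: orth_compl_def)
  ultimately have "orthonormal_basis e" by (simp add: orthonormal_basis_iff)
  then interpret onb e by (rule onb.intro)
  have "e ` {..<n} = u ` {..<n}" using e_u by auto
  then have range_n: "range (proj_op e n) = V" using range_proj[of n] spanu by simp
  have range_nk: "range (proj_op e (n + k)) = V'"
    unfolding range_proj
  proof
    have ev: "e (n + j) = v j" if "j < k" for j using f_pow[OF that, of 0] e_f[of j] by simp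
    have "e m \<in> V'" if "m < n + k" for m
    proof (cases "m < n")
      case True
      then show ?thesis using uV VV' e_u by auto
    next
      case False
      then show ?thesis using that ev[of "m - n"] vW[of "m - n"] W_iff by auto
    qed
    then show "cvs.span (e ` {..<n + k}) \<subseteq> V'"
      by (intro cvs.span_minimal subV') auto
    have "u ` {..<n} \<subseteq> e ` {..<n + k}"
    proof
      fix z assume "z \<in> u ` {..<n}"
      then obtain i where "i < n" "z = e i" using e_u by auto
      then show "z \<in> e ` {..<n + k}" by auto
    qed
    then have V_sub: "V \<subseteq> cvs.span (e ` {..<n + k})"
      using cvs.span_mono spanu by metis
    have "v ` {..<k} \<subseteq> e ` {..<n + k}"
    proof
      fix z assume "z \<in> v ` {..<k}"
      then obtain i where "i < k" "z = e (n + i)" using ev by auto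
      then show "z \<in> e ` {..<n + k}" by auto
    qed
    then have W_sub: "W \<subseteq> cvs.span (e ` {..<n + k})"
      using cvs.span_mono spanv by metis
    show "V' \<subseteq> cvs.span (e ` {..<n + k})"
    proof
      fix d assume d: "d \<in> V'"
      then obtain p q where "p \<in> V" "q \<in> W" "d = p + q"
        using orth_diff_decomposition[OF subV(1) subV' subV(2) VV' d] unfolding W_def by blast
      then show "d \<in> cvs.span (e ` {..<n + k})" using V_sub W_sub cvs.span_add by blast
    qed
  qed
  have T_e: "T (e m) = e (m + k)" if m: "n \<le> m" for m
  proof -
    obtain t where t: "m = n + t" using le_Suc_ex[OF m] by blast
    have "f (t + k) = T (f t)" using k by (simp add: f_def)
    then show ?thesis using e_f[of t] e_f[of "t + k"] t by (simp add: add.assoc)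
  qed
  have "shift_tail e T n k"
  proof
    show "bounded_clinear_op T" by (rule b)
  next
    fix z assume z: "proj_op e n z = 0"
    \<comment> \<open>By continuity \<open>T\<close> acts termwise on the expansion of
      \<open>z\<close>, whose coefficients below \<open>n\<close> vanish.\<close>
    have "(\<lambda>m. T (scaleC (cinner z (e m)) (e m))) sums T z"
      by (rule bounded_linear.sums[OF bounded_clinear_op_bounded_linear[OF b] basis_expansion])
    moreover have "T (scaleC (cinner z (e m)) (e m)) = scaleC (cinner z (e m)) (e (m + k))" for m
      using z T_e[of m] by (cases "m < n") (simp_all add: proj_zero_iff bop_simps[OF b])
    ultimately show "T z = shift_op e k z"
      unfolding shift_op_def by (simp add: sums_unique)
  next
    fix x
    have "proj_op e n x \<in> V" using range_n by blast
    \<comment> \<open>\<open>T\<close> maps \<open>V\<close> into \<open>V'\<close>: if T (adj T y)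
      = y, then \<open>adj T y\<close> is fixed by T*T, hence orthogonal to
      \<open>V\<close>.\<close>
    then have "T (proj_op e n x) \<in> V'"
      unfolding V_eq V'_eq orth_compl_def by (simp add: cinner_adj[OF b])
    then show "proj_op e (n + k) (T (proj_op e n x)) = T (proj_op e n x)"
      unfolding range_nk[symmetric] range_proj_iff .
  qed
  then show ?thesis using range_n range_nk
    by (intro exI[of _ e]) (simp add: V_def V'_def)
qed

section \<open>The equivalence\<close>

theorem theorem3p2:
  fixes T :: "'a::chilbert_space \<Rightarrow> 'a" and n k :: nat
  assumes sep: "separable_space TYPE('a)"
    and infdim: "\<not> fin_cdim (UNIV :: 'a set)"
    and bdd: "bounded_clinear_op T"
    and n_pos: "0 < n" and k_pos: "0 < k"
  shows "(contraction T \<and> completely_non_unitary T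
          \<and> defect_space T \<subseteq> defect_space (adj T)
          \<and> has_cdim (defect_space T) n
          \<and> fin_cdim (defect_space (adj T))
          \<and> has_cdim (orth_diff (defect_space (adj T)) (defect_space T)) k)
    \<longleftrightarrow>
    (\<exists>e. orthonormal_basis e \<and>
       (let S = shift_op e k; P = proj_op e; F = (\<lambda>x. T x - S x);
            F1 = (\<lambda>x. F x + S (P n x)); Fr = F_iter e k n F1 in
        finite_rank F
        \<and> rank_eq (\<lambda>x. P n x - adj F1 (F1 x)) n
        \<and> (\<forall>x. F1 (x - P n x) = 0) \<and> (\<forall>x. F1 x - P (n + k) (F1 x) = 0)
        \<and> (\<exists>lam::real. lam \<ge> 0 \<and> (\<forall>x. lam * (norm (adj F1 x))\<^sup>2 - (norm (F1 x))\<^sup>2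
                                  \<le> lam * (norm (P (n + k) x))\<^sup>2 - (norm (P n x))\<^sup>2))
        \<and> (\<forall>r\<ge>1. \<forall>x. norm (Fr r x) \<le> norm (P n x) \<and> norm (adj (Fr r) x) \<le> norm (P (n + k * r) x))
        \<and> (\<forall>x. (\<forall>r\<ge>1. norm (Fr r x) = norm (P n x) \<and> norm (adj (Fr r) x) = norm (P (n + k * r) x))
               \<longrightarrow> x = 0)))"
    (is "?L \<longleftrightarrow> ?R")
proof
  assume L: ?L
  then have T: "contraction T" and cnu: "completely_non_unitary T" by auto
  obtain e where e: "shift_tail e T n k" and d: "defect_space T = range (proj_op e n)"
    and d': "defect_space (adj T) = range (proj_op e (n + k))"
    using adapted_basis[OF T cnu, of n k] L k_pos by blast
  interpret shift_tail e T n k by (rule e)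
  have F1_eq: "T x - shift_op e k x + shift_op e k (proj_op e n x) = F1 x" for x
    by (rule compression_eq[OF _ bop]) (rule tail)
  have rank: "rank_eq (\<lambda>x. proj_op e n x - adj F1 (F1 x)) n"
    unfolding defect_sq_eq[OF T] rank_eq_def
    using range_defect_sq[OF T, of n] L by simp
  show ?R
  proof (rule exI[of _ e], unfold Let_def F1_eq,
      intro conjI allI impI)
    show "orthonormal_basis e" by (rule basis)
    show "finite_rank (\<lambda>x. T x - shift_op e k x)" by (rule finite_rank_diff_shift)
    show "T (proj_op e n (x - proj_op e n x)) = 0" for x
      by (simp add: proj_compl_zero bop_simps[OF bop])
    show "T (proj_op e n x) - proj_op e (n + k) (T (proj_op e n x)) = 0" for x
      by (simp add: corner)
    show "\<exists>lam\<ge>0. \<forall>x. lam * (norm (adj F1 x))\<^sup>2 - (norm (F1 x))\<^sup>2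
        \<le> lam * (norm (proj_op e (n + k) x))\<^sup>2 - (norm (proj_op e n x))\<^sup>2"
      by (rule domination[OF T d'])
    show "norm (Fr r x) \<le> norm (proj_op e n x)" "norm (adj (Fr r) x) \<le> norm (proj_op e (n + k * r) x)"
      if "1 \<le> r" for r x using F_iter_bounds[OF T that] .
    show "x = 0" if "\<forall>r\<ge>1. norm (Fr r x) = norm (proj_op e n x)
        \<and> norm (adj (Fr r) x) = norm (proj_op e (n + k * r) x)" for x
      using cnu that unfolding completely_non_unitary_iff_F_iter[OF T] by blast
  qed (rule rank)
next
  assume ?R
  then show ?L
  proof (unfold Let_def, elim exE conjE)
    fix e :: "nat \<Rightarrow> 'a"
    assume e: "orthonormal_basis e"
    and rank0: "rank_eq (\<lambda>x. proj_op e n x - adj (\<lambda>x. T x - shift_op e k x + shift_op e k (proj_op e n x))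
      (T x - shift_op e k x + shift_op e k (proj_op e n x))) n"
    and F1_tail: "\<forall>x. T (x - proj_op e n x) - shift_op e k (x - proj_op e n x)
      + shift_op e k (proj_op e n (x - proj_op e n x)) = 0"
    and F1_range: "\<forall>x. T x - shift_op e k x + shift_op e k (proj_op e n x)
      - proj_op e (n + k) (T x - shift_op e k x + shift_op e k (proj_op e n x)) = 0"
    and bound0: "\<forall>r\<ge>1. \<forall>x.
      norm (F_iter e k n (\<lambda>x. T x - shift_op e k x + shift_op e k (proj_op e n x)) r x)
        \<le> norm (proj_op e n x)
      \<and> norm (adj (F_iter e k n (\<lambda>x. T x - shift_op e k x + shift_op e k (proj_op e n x)) r) x)
        \<le> norm (proj_op e (n + k * r) x)"
    and only0: "\<forall>x. (\<forall>r\<ge>1. norm (F_iter e k n (\<lambda>x. T x - shift_op e k x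
        + shift_op e k (proj_op e n x)) r x) = norm (proj_op e n x)
      \<and> norm (adj (F_iter e k n (\<lambda>x. T x - shift_op e k x + shift_op e k (proj_op e n x)) r) x)
        = norm (proj_op e (n + k * r) x)) \<longrightarrow> x = 0"
    interpret onb e using e by (rule onb.intro)
    \<comment> \<open>When P_n z = 0, the first half of condition (2) reads T z - S z = 0.\<close>
    have tail: "T z = shift_op e k z" if "proj_op e n z = 0" for z
      using F1_tail[rule_format, of z] that by (simp add: bop_simps[OF bop_shift])
    have F1_eq: "T x - shift_op e k x + shift_op e k (proj_op e n x) = T (proj_op e n x)" for x
      by (rule compression_eq[OF _ bdd]) (rule tail)
    interpret shift_tail e T n k
    proof
      show "proj_op e (n + k) (T (proj_op e n x)) = T (proj_op e n x)" for x
        using F1_range[rule_format, of x] unfolding F1_eq by simp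
    qed (use bdd tail in auto)
    have rank: "rank_eq (\<lambda>x. proj_op e n x - adj F1 (F1 x)) n"
      using rank0 unfolding F1_eq .
    \<comment> \<open>The case r = 1 of the first bound in (4), after adding back the isometric
      tail.\<close>
    have T: "contraction T"
      using bound0[rule_format, of 1] unfolding F1_eq by (intro contraction_if_F_iter_bound) simp
    have cnu: "completely_non_unitary T"
      using only0 unfolding F1_eq completely_non_unitary_iff_F_iter[OF T] .
    note defect = defect_space_of_rank[OF T rank]
    \<comment> \<open>The difference of the two defect spaces is the span of the \<open>k\<close>
      basis vectors with indices from \<open>n\<close> to n + k - 1, which gives its
      dimension.\<close>
    have "orth_diff (range (proj_op e (n + k))) (range (proj_op e n))
        = {x. proj_op e (n + k) x = x \<and> proj_op e n x = 0}"
      using orth_compl_range_proj[of n] by (auto simp: orth_diff_def orth_compl_def range_proj_iff)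
    also have "\<dots> = cvs.span ((\<lambda>j. e (n + j)) ` {..<k})"
    proof
      show "cvs.span ((\<lambda>j. e (n + j)) ` {..<k}) \<subseteq> {x. proj_op e (n + k) x = x \<and> proj_op e n x = 0}"
        by (rule cvs.span_minimal) (auto simp: cvs.subspace_def bop_simps[OF bop_proj] proj_basis)
      show "{x. proj_op e (n + k) x = x \<and> proj_op e n x = 0} \<subseteq> cvs.span ((\<lambda>j. e (n + j)) ` {..<k})"
      proof
        fix x assume "x \<in> {x. proj_op e (n + k) x = x \<and> proj_op e n x = 0}"
        then have x: "x = (\<Sum>m<n + k. scaleC (cinner x (e m)) (e m))" and x0: "proj_op e n x = 0"
          by (auto simp: proj_op_def)
        have "scaleC (cinner x (e m)) (e m) \<in> cvs.span ((\<lambda>j. e (n + j)) ` {..<k})" if "m < n + k" for m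
        proof (cases "m < n")
          case True
          then show ?thesis using x0 by (simp add: proj_zero_iff cvs.span_zero)
        next
          case False
          then have "e m = e (n + (m - n))" "m - n < k" using that by auto
          then show ?thesis by (intro cvs.span_scale cvs.span_base) blast
        qed
        then show "x \<in> cvs.span ((\<lambda>j. e (n + j)) ` {..<k})"
          by (subst x) (intro cvs.span_sum, simp)
      qed
    qed
    finally have diff: "orth_diff (range (proj_op e (n + k))) (range (proj_op e n))
        = cvs.span ((\<lambda>j. e (n + j)) ` {..<k})" .
    have "has_cdim (cvs.span ((\<lambda>j. e (n + j)) ` {..<k})) k"
      by (intro orthonormal_has_cdim) (simp add: orthonormal_on_def ortho)
    moreover have "range (proj_op e n) \<subseteq> range (proj_op e (n + k))"
      using proj_id_mono[of n _ "n + k"] by (auto simp: range_proj_iff proj_proj)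
    ultimately show ?L
      using T cnu has_cdim_range_proj[of n] has_cdim_range_proj[of "n + k"]
      unfolding defect diff fin_cdim_def by blast
  qed
qed

end
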